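(* Let $\Theta$ be a non-empty set and let $(H_\theta)_{\theta\in\Theta}$, $(M(\theta))_{\theta\in\Theta}$, $(A(\theta))_{\theta\in\Theta}$, $c>0$, $(N(\theta))_{\theta\in\Theta}$ satisfy the standing assumptions and the fibre hypothesis stated in the context. For $\theta\in\Theta$ let $\widetilde M(\theta)\in L(H_\theta)$ be such that $\|\widetilde M\|_\infty:=\sup_{\theta\in\Theta}\|\widetilde M(\theta)\|<\infty$ and $\operatorname{Re}\widetilde M(\theta)\ge c$ for all $\theta\in\Theta$. Assume furthermore that $$\pi_{N(\theta)}M(\theta)\pi_{N(\theta)}=\pi_{N(\theta)}\widetilde M(\theta)\pi_{N(\theta)}\qquad(\theta\in\Theta).$$ Then there exists $\kappa>0$ such that for all $\theta\in\Theta$ and all $\varepsilon>0$ one has $$\Big\|\mathcal{B}_\varepsilon(\theta)^{-1}-\big(\widetilde M(\theta)+\tfrac1\varepsilon A(\theta)\big)^{-1}\Big\|\le\kappa\,\varepsilon .$$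
   Context: Standing assumptions. $\Theta$ is a non-empty set, $(H_\theta)_{\theta\in\Theta}$ is a family of Hilbert spaces, $M(\theta)\in L(H_\theta)$ (bounded linear operators) with $\|M\|_\infty:=\sup_{\theta\in\Theta}\|M(\theta)\|<\infty$, and $A(\theta):\operatorname{dom}(A(\theta))\subseteq H_\theta\to H_\theta$ is densely defined and closed. There is $c\in(0,\infty)$ such that for all $\theta\in\Theta$: $\operatorname{Re}M(\theta):=\tfrac12(M(\theta)+M(\theta)^* )\ge c$ and $A(\theta)=-A(\theta)^*$. For $\varepsilon>0$ put $\mathcal{B}_\varepsilon(\theta):=M(\theta)+\tfrac1\varepsilon A(\theta)$ with domain $\operatorname{dom}(A(\theta))$. Fibre hypothesis. For every $\theta\in\Theta$ there is given a closed subspace $N(\theta)\subseteq H_\theta$; put $R(\theta):=N(\theta)^\perp$, let $\iota_{N(\theta)}:N(\theta)\hookrightarrow H_\theta$, $\iota_{R(\theta)}:R(\theta)\hookrightarrow H_\theta$ be the canonical embeddings and $\pi_{N(\theta)}:=\iota_{N(\theta)}\iota_{N(\theta)}^*$, $\pi_{R(\theta)}:=\iota_{R(\theta)}\iota_{R(\theta)}^*$ the orthogonal projections, such that (a) $A(\theta)\pi_{N(\theta)}$ is bounded for all $\theta\in\Theta$; (b) $\pi_{R(\theta)}A(\theta)\subseteq A(\theta)\pi_{R(\theta)}$ (inclusion of operators) for all $\theta\in\Theta$; (c) $\iota_{R(\theta)}^*A(\theta)\iota_{R(\theta)}$ is boundedly invertible on $R(\theta)$, uniformly in $\theta$: $C_R:=\sup_{\theta\in\Theta}\|(\iota_{R(\theta)}^*A(\theta)\iota_{R(\theta)})^{-1}\|_{L(R(\theta))}<\infty$.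 *)

theory Defs
  imports "HOL-Analysis.Analysis" "HOL-Algebra.Module"
begin

section \<open>Complex Hilbert spaces with explicit carrier\<close>

text \<open>
  A family of Hilbert spaces has a different space at each index, so spaces are carrier-based
  structures over a common element type, in the style of HOL-Algebra. The fields \<open>mult\<close> and \<open>one\<close>
  inherited from the module record are unused.
\<close>

definition complex_field :: "complex ring" where
  "complex_field = \<lparr>carrier = UNIV, monoid.mult = (*), one = 1, zero = 0, add = (+)\<rparr>"

record 'h hilbert = "(complex, 'h) module" +
  inprod :: "'h \<Rightarrow> 'h \<Rightarrow> complex"

definition hnorm :: "'h hilbert \<Rightarrow> 'h \<Rightarrow> real" where
  "hnorm H x = sqrt (Re (inprod H x x))"

text \<open>The locale \<open>Metric_space\<close> requires symmetry and non-negativity off the carrier as well.\<close>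

definition hdist :: "'h hilbert \<Rightarrow> 'h \<Rightarrow> 'h \<Rightarrow> real" where
  "hdist H x y = (if x \<in> carrier H \<and> y \<in> carrier H then hnorm H (x \<ominus>\<^bsub>H\<^esub> y) else 0)"

abbreviation htop :: "'h hilbert \<Rightarrow> 'h topology" where
  "htop H \<equiv> Metric_space.mtopology (carrier H) (hdist H)"

locale inner_product_space = module complex_field H for H :: "'h hilbert" +
  assumes inprod_add: "\<lbrakk>x \<in> carrier H; y \<in> carrier H; z \<in> carrier H\<rbrakk> \<Longrightarrow>
      inprod H (x \<oplus>\<^bsub>H\<^esub> y) z = inprod H x z + inprod H y z"
    and inprod_smult: "\<lbrakk>x \<in> carrier H; y \<in> carrier H\<rbrakk> \<Longrightarrow>
      inprod H (a \<odot>\<^bsub>H\<^esub> x) y = a * inprod H x y"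
    and inprod_commute: "\<lbrakk>x \<in> carrier H; y \<in> carrier H\<rbrakk> \<Longrightarrow>
      inprod H y x = cnj (inprod H x y)"
    and inprod_pos: "\<lbrakk>x \<in> carrier H; x \<noteq> \<zero>\<^bsub>H\<^esub>\<rbrakk> \<Longrightarrow> 0 < Re (inprod H x x)"

locale hilbert_space = inner_product_space +
  assumes complete: "Metric_space.mcomplete (carrier H) (hdist H)"

context inner_product_space
begin

lemma carrier_complex_field [simp]: "carrier complex_field = UNIV"
  by (simp add: complex_field_def)

lemma inprod_add_right:
  "\<lbrakk>x \<in> carrier H; y \<in> carrier H; z \<in> carrier H\<rbrakk> \<Longrightarrow>
    inprod H z (x \<oplus>\<^bsub>H\<^esub> y) = inprod H z x + inprod H z y"
  by (metis M.a_closed complex_cnj_add inprod_add inprod_commute)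

lemma inprod_smult_right:
  "\<lbrakk>x \<in> carrier H; y \<in> carrier H\<rbrakk> \<Longrightarrow> inprod H y (a \<odot>\<^bsub>H\<^esub> x) = cnj a * inprod H y x"
  by (metis UNIV_I carrier_complex_field complex_cnj_mult inprod_commute inprod_smult smult_closed)

lemma inprod_zero_left [simp]: "x \<in> carrier H \<Longrightarrow> inprod H \<zero>\<^bsub>H\<^esub> x = 0"
  using inprod_add[of "\<zero>\<^bsub>H\<^esub>" "\<zero>\<^bsub>H\<^esub>" x] by simp

lemma inprod_self_real: "x \<in> carrier H \<Longrightarrow> inprod H x x = of_real (Re (inprod H x x))"
  using inprod_commute[of x x] by (simp add: complex_eq_iff)

lemma inprod_nonneg: "x \<in> carrier H \<Longrightarrow> 0 \<le> Re (inprod H x x)"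
  using inprod_pos[of x] by (cases "x = \<zero>\<^bsub>H\<^esub>") auto

lemma hnorm_nonneg: "x \<in> carrier H \<Longrightarrow> 0 \<le> hnorm H x"
  by (simp add: hnorm_def inprod_nonneg)

lemma hnorm_sq: "x \<in> carrier H \<Longrightarrow> (hnorm H x)\<^sup>2 = Re (inprod H x x)"
  by (simp add: hnorm_def inprod_nonneg)

lemma hnorm_eq_0: "x \<in> carrier H \<Longrightarrow> hnorm H x = 0 \<longleftrightarrow> x = \<zero>\<^bsub>H\<^esub>"
  using inprod_pos[of x] by (cases "x = \<zero>\<^bsub>H\<^esub>") (auto simp: hnorm_def)

lemma Re_inprod_le:
  assumes "x \<in> carrier H" "y \<in> carrier H"
  shows "Re (inprod H x y) \<le> hnorm H x * hnorm H y"
proof (cases "y = \<zero>\<^bsub>H\<^esub>")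
  case True
  then have "inprod H x y = 0"
    using inprod_commute[OF assms(2,1)] assms by simp
  with True assms show ?thesis by (simp add: hnorm_def)
next
  case False
  define p where "p = Re (inprod H x x)"
  define q where "q = Re (inprod H x y)"
  define r where "r = Re (inprod H y y)"
  have r: "0 < r" using False assms(2) inprod_pos by (simp add: r_def)
  let ?z = "x \<oplus>\<^bsub>H\<^esub> (of_real (- q / r) \<odot>\<^bsub>H\<^esub> y)"
  have sy: "of_real (- q / r) \<odot>\<^bsub>H\<^esub> y \<in> carrier H" using assms by simp
  have yx: "Re (inprod H y x) = q"
    using inprod_commute[OF assms] by (simp add: q_def)
  have "0 \<le> Re (inprod H ?z ?z)"
    using sy assms by (intro inprod_nonneg) simp
  also have "\<dots> = p + 2 * (- q / r) * q + (- q / r)\<^sup>2 * r"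
    using sy assms yx by (simp add: inprod_add inprod_add_right inprod_smult inprod_smult_right
        p_def q_def r_def power2_eq_square algebra_simps)
  also have "\<dots> = p - q\<^sup>2 / r" using r by (simp add: field_simps power2_eq_square)
  finally have "q\<^sup>2 \<le> p * r" using r by (simp add: field_simps)
  then have "sqrt (q\<^sup>2) \<le> sqrt (p * r)" by (rule real_sqrt_le_mono)
  then show ?thesis
    by (simp add: hnorm_def p_def q_def r_def real_sqrt_mult)
qed

lemma hnorm_triangle:
  assumes "x \<in> carrier H" "y \<in> carrier H"
  shows "hnorm H (x \<oplus>\<^bsub>H\<^esub> y) \<le> hnorm H x + hnorm H y"
proof (rule power2_le_imp_le)
  have "Re (inprod H y x) = Re (inprod H x y)"
    using inprod_commute[OF assms] by simp
  then have "(hnorm H (x \<oplus>\<^bsub>H\<^esub> y))\<^sup>2 = (hnorm H x)\<^sup>2 + 2 * Re (inprod H x y) + (hnorm H y)\<^sup>2"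
    using assms by (simp add: hnorm_sq inprod_add inprod_add_right)
  also have "\<dots> \<le> (hnorm H x + hnorm H y)\<^sup>2"
    using Re_inprod_le[OF assms] by (simp add: power2_sum)
  finally show "(hnorm H (x \<oplus>\<^bsub>H\<^esub> y))\<^sup>2 \<le> (hnorm H x + hnorm H y)\<^sup>2" .
  show "0 \<le> hnorm H x + hnorm H y"
    using assms by (simp add: hnorm_nonneg)
qed

lemma hnorm_uminus:
  assumes "x \<in> carrier H"
  shows "hnorm H (\<ominus>\<^bsub>H\<^esub> x) = hnorm H x"
proof -
  have nx: "\<ominus>\<^bsub>H\<^esub> x \<in> carrier H" using assms by simp
  have l: "inprod H (\<ominus>\<^bsub>H\<^esub> x) z = - inprod H x z" if "z \<in> carrier H" for z
    using inprod_add[OF assms nx that] assms that by (simp add: M.r_neg add_eq_0_iff)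
  have "inprod H (\<ominus>\<^bsub>H\<^esub> x) (\<ominus>\<^bsub>H\<^esub> x) = - inprod H x (\<ominus>\<^bsub>H\<^esub> x)"
    using l[OF nx] .
  also have "inprod H x (\<ominus>\<^bsub>H\<^esub> x) = - inprod H x x"
    using l[OF assms] inprod_commute[OF nx assms] inprod_commute[OF assms assms] by simp
  finally have "inprod H (\<ominus>\<^bsub>H\<^esub> x) (\<ominus>\<^bsub>H\<^esub> x) = inprod H x x" by simp
  then show ?thesis by (simp add: hnorm_def)
qed

lemma hdist_Metric_space: "Metric_space (carrier H) (hdist H)"
proof
  fix x y show "0 \<le> hdist H x y"
    by (simp add: hdist_def hnorm_nonneg)
next
  fix x y show "hdist H x y = hdist H y x"
  proof (cases "x \<in> carrier H \<and> y \<in> carrier H")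
    case True
    then have "x \<ominus>\<^bsub>H\<^esub> y = \<ominus>\<^bsub>H\<^esub> (y \<ominus>\<^bsub>H\<^esub> x)"
      by (simp add: a_minus_def M.minus_add M.a_comm)
    with True show ?thesis by (simp add: hdist_def hnorm_uminus)
  qed (auto simp: hdist_def)
next
  fix x y assume "x \<in> carrier H" "y \<in> carrier H"
  moreover from this have "(x \<ominus>\<^bsub>H\<^esub> y) \<oplus>\<^bsub>H\<^esub> y = x" "y \<ominus>\<^bsub>H\<^esub> y = \<zero>\<^bsub>H\<^esub>"
    by (simp_all add: a_minus_def M.a_assoc M.l_neg M.r_neg)
  ultimately show "hdist H x y = 0 \<longleftrightarrow> x = y"
    by (auto simp: hdist_def hnorm_eq_0)
next
  fix x y z assume xyz: "x \<in> carrier H" "y \<in> carrier H" "z \<in> carrier H"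
  then have "x \<ominus>\<^bsub>H\<^esub> z = (x \<ominus>\<^bsub>H\<^esub> y) \<oplus>\<^bsub>H\<^esub> (y \<ominus>\<^bsub>H\<^esub> z)"
    by (simp add: a_minus_def M.a_assoc M.r_neg1)
  with xyz show "hdist H x z \<le> hdist H x y + hdist H y z"
    by (simp add: hdist_def hnorm_triangle)
qed

end

sublocale inner_product_space \<subseteq> Metric_space "carrier H" "hdist H"
  by (rule hdist_Metric_space)

definition closed_subspace :: "'h hilbert \<Rightarrow> 'h set \<Rightarrow> bool" where
  "closed_subspace H N \<longleftrightarrow> submodule N complex_field H \<and> closedin (htop H) N"

definition orth_compl :: "'h hilbert \<Rightarrow> 'h set \<Rightarrow> 'h set" where
  "orth_compl H N = {x \<in> carrier H. \<forall>y\<in>N. inprod H x y = 0}"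

text \<open>A closed subspace as a Hilbert space in its own right.\<close>

abbreviation sub_hilbert :: "'h hilbert \<Rightarrow> 'h set \<Rightarrow> 'h hilbert" where
  "sub_hilbert H N \<equiv> H\<lparr>carrier := N\<rparr>"


section \<open>Operators\<close>

text \<open>
  Operators, bounded or unbounded, are identified with their graphs, so that \<open>Domain T\<close> is the
  domain, the converse is the inverse, and \<open>\<subseteq>\<close> is inclusion of operators. Below, \<open>T\<close> acts from \<open>H\<close>
  to \<open>K\<close>.
\<close>

definition linear_operator ::
  "'h hilbert \<Rightarrow> 'k hilbert \<Rightarrow> ('h \<times> 'k) set \<Rightarrow> bool" where
  "linear_operator H K T \<longleftrightarrow> T \<subseteq> carrier H \<times> carrier K \<and> single_valued T \<and>
     (\<zero>\<^bsub>H\<^esub>, \<zero>\<^bsub>K\<^esub>) \<in> T \<and>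
     (\<forall>(x, y)\<in>T. \<forall>(x', y')\<in>T. (x \<oplus>\<^bsub>H\<^esub> x', y \<oplus>\<^bsub>K\<^esub> y') \<in> T) \<and>
     (\<forall>a. \<forall>(x, y)\<in>T. (a \<odot>\<^bsub>H\<^esub> x, a \<odot>\<^bsub>K\<^esub> y) \<in> T)"

definition densely_defined :: "'h hilbert \<Rightarrow> ('h \<times> 'k) set \<Rightarrow> bool" where
  "densely_defined H T \<longleftrightarrow> htop H closure_of Domain T = carrier H"

definition closed_operator ::
  "'h hilbert \<Rightarrow> 'k hilbert \<Rightarrow> ('h \<times> 'k) set \<Rightarrow> bool" where
  "closed_operator H K T \<longleftrightarrow> closedin (prod_topology (htop H) (htop K)) T"

definition opnorm :: "'h hilbert \<Rightarrow> 'k hilbert \<Rightarrow> ('h \<times> 'k) set \<Rightarrow> ennreal" where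
  "opnorm H K T = (SUP (x, y)\<in>{(x, y) \<in> T. hnorm H x \<le> 1}. ennreal (hnorm K y))"

text \<open>\<open>bounded_operators H K\<close> is \<open>L(H, K)\<close>: bounded and everywhere defined.\<close>

definition bounded_operators :: "'h hilbert \<Rightarrow> 'k hilbert \<Rightarrow> ('h \<times> 'k) set set" where
  "bounded_operators H K =
     {T. linear_operator H K T \<and> Domain T = carrier H \<and> opnorm H K T < \<infinity>}"

definition op_plus ::
  "'k hilbert \<Rightarrow> ('h \<times> 'k) set \<Rightarrow> ('h \<times> 'k) set \<Rightarrow> ('h \<times> 'k) set" where
  "op_plus K S T = {(x, y \<oplus>\<^bsub>K\<^esub> z) |x y z. (x, y) \<in> S \<and> (x, z) \<in> T}"

definition op_scale :: "'k hilbert \<Rightarrow> complex \<Rightarrow> ('h \<times> 'k) set \<Rightarrow> ('h \<times> 'k) set" where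
  "op_scale K a T = {(x, a \<odot>\<^bsub>K\<^esub> y) |x y. (x, y) \<in> T}"

definition op_minus ::
  "'k hilbert \<Rightarrow> ('h \<times> 'k) set \<Rightarrow> ('h \<times> 'k) set \<Rightarrow> ('h \<times> 'k) set" where
  "op_minus K S T = op_plus K S (op_scale K (-1) T)"

text \<open>Composition in the order usual for operators; relation composition \<open>O\<close> is the reverse.\<close>

abbreviation op_comp :: "('k \<times> 'l) set \<Rightarrow> ('h \<times> 'k) set \<Rightarrow> ('h \<times> 'l) set"
    (infixr "\<circ>\<^sub>o" 75) where
  "S \<circ>\<^sub>o T \<equiv> T O S"

text \<open>
  Adjoint: \<open>y \<in> dom T*\<close> with \<open>T* y = z\<close> iff \<open>\<langle>T x, y\<rangle> = \<langle>x, z\<rangle>\<close> for all \<open>x \<in> dom T\<close>. For densely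
  defined \<open>T\<close> this is again (the graph of) an operator.
\<close>

definition op_adjoint ::
  "'h hilbert \<Rightarrow> 'k hilbert \<Rightarrow> ('h \<times> 'k) set \<Rightarrow> ('k \<times> 'h) set" where
  "op_adjoint H K T = {(y, z) \<in> carrier K \<times> carrier H.
     \<forall>(x, w)\<in>T. inprod K w y = inprod H x z}"

definition op_Re :: "'h hilbert \<Rightarrow> ('h \<times> 'h) set \<Rightarrow> ('h \<times> 'h) set" where
  "op_Re H T = op_scale H (1/2) (op_plus H T (op_adjoint H H T))"

text \<open>\<open>T \<ge> c\<close> in the order of self-adjoint bounded operators; for such \<open>T\<close> the form
  \<open>\<langle>T x, x\<rangle>\<close> is real.\<close>

definition op_ge :: "'h hilbert \<Rightarrow> ('h \<times> 'h) set \<Rightarrow> real \<Rightarrow> bool" where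
  "op_ge H T c \<longleftrightarrow> (\<forall>(x, y)\<in>T. c * (hnorm H x)\<^sup>2 \<le> Re (inprod H y x))"

definition boundedly_invertible ::
  "'h hilbert \<Rightarrow> 'k hilbert \<Rightarrow> ('h \<times> 'k) set \<Rightarrow> bool" where
  "boundedly_invertible H K T \<longleftrightarrow> T\<inverse> \<in> bounded_operators K H"

text \<open>The canonical embedding of a closed subspace \<open>N\<close> and the orthogonal projection onto it.\<close>

definition op_embed :: "'h set \<Rightarrow> ('h \<times> 'h) set" where
  "op_embed N = Id_on N"

definition op_embed_adj :: "'h hilbert \<Rightarrow> 'h set \<Rightarrow> ('h \<times> 'h) set" where
  "op_embed_adj H N = op_adjoint (sub_hilbert H N) H (op_embed N)"

definition op_proj :: "'h hilbert \<Rightarrow> 'h set \<Rightarrow> ('h \<times> 'h) set" where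
  "op_proj H N = op_embed N \<circ>\<^sub>o op_embed_adj H N"

text \<open>The compression \<open>\<iota>\<^sub>N* T \<iota>\<^sub>N\<close> of \<open>T\<close> to \<open>N\<close>.\<close>

definition compression :: "'h hilbert \<Rightarrow> 'h set \<Rightarrow> ('h \<times> 'h) set \<Rightarrow> ('h \<times> 'h) set" where
  "compression H N T = op_embed_adj H N \<circ>\<^sub>o T \<circ>\<^sub>o op_embed N"

text \<open>The operator \<open>M + A / \<epsilon>\<close>; its domain is that of \<open>A\<close> since \<open>M\<close> is everywhere defined.\<close>

definition B_op ::
  "'h hilbert \<Rightarrow> ('h \<times> 'h) set \<Rightarrow> ('h \<times> 'h) set \<Rightarrow> real \<Rightarrow> ('h \<times> 'h) set" where
  "B_op H M A \<epsilon> = op_plus H M (op_scale H (complex_of_real (1 / \<epsilon>)) A)"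

end

theory Submission
  imports Defs
begin

text \<open>
  Write \<open>R = N\<^sup>\<bottom>\<close>, fix \<open>f\<close>, and let \<open>u\<close> and \<open>v\<close> solve \<open>(M + A/\<epsilon>) u = f\<close> and \<open>(M' + A/\<epsilon>) v = f\<close>, where
  \<open>M'\<close> is the perturbed coefficient. Since \<open>A\<close> is skew, \<open>Re \<langle>A x, x\<rangle> = 0\<close>, and so coercivity of \<open>M\<close>
  gives \<open>c \<parallel>u\<parallel> \<le> \<parallel>f\<parallel>\<close>, whatever \<open>\<epsilon>\<close> is; likewise for \<open>v\<close>.

  The parts of \<open>u\<close> and \<open>v\<close> in \<open>R\<close> are small one by one. Indeed \<open>A u = \<epsilon> (f - M u)\<close> has norm
  \<open>O(\<epsilon>) \<parallel>f\<parallel>\<close>; as \<open>R\<close> reduces \<open>A\<close> and \<open>A\<close> has an inverse of norm at most \<open>C\<close> on \<open>R\<close>, the part of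
  \<open>u\<close> in \<open>R\<close> is \<open>O(\<epsilon>) \<parallel>f\<parallel>\<close> as well (lemma \<open>orthogonal_part_solution\<close>).

  The parts in \<open>N\<close> need not be small, but their difference \<open>n\<close> is. Subtract the two equations and
  test with \<open>n\<close>. Since \<open>A\<close> leaves \<open>R\<close> invariant, only \<open>\<langle>A n, n\<rangle>\<close> remains of the unbounded term, and
  its real part vanishes. Since \<open>M\<close> and \<open>M'\<close> have the same compression to \<open>N\<close>, what remains of the
  bounded terms is \<open>Re \<langle>M n, n\<rangle>\<close> and contributions of the small parts in \<open>R\<close>. Coercivity then
  bounds \<open>n\<close> linearly in \<open>\<epsilon>\<close> (lemma \<open>resolvent_difference\<close>). Testing with \<open>u - v\<close> instead
  of its part in \<open>N\<close> would leave the pairing of the large part of \<open>v\<close> with the part of \<open>u - v\<close> in \<open>R\<close>,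
  which is only \<open>O(\<epsilon>) \<parallel>f\<parallel>\<^sup>2\<close>; this bounds \<open>\<parallel>u - v\<parallel>\<^sup>2\<close> by \<open>O(\<epsilon>) \<parallel>f\<parallel>\<^sup>2\<close> and gives the rate \<open>\<surd>\<epsilon>\<close>.

  Invertibility of \<open>M + A/\<epsilon>\<close> comes from the same coercivity. It makes the operator injective
  with closed range, and a vector \<open>e\<close> orthogonal to the range lies in the domain of \<open>A\<^sup>* = -A\<close>, so that
  \<open>0 = Re \<langle>(M + A/\<epsilon>) e, e\<rangle> \<ge> c \<parallel>e\<parallel>\<^sup>2\<close> (lemma \<open>B_boundedly_invertible\<close>). This uses the projection
  theorem, and the Riesz representation theorem for the adjoint of \<open>M\<close>; both are
  proved here for Hilbert spaces with explicit carrier.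
\<close>

section \<open>Inner product spaces with explicit carrier\<close>

context inner_product_space
begin

lemma inprod_diff:
  assumes "x \<in> carrier H" "y \<in> carrier H" "z \<in> carrier H"
  shows "inprod H (x \<ominus>\<^bsub>H\<^esub> y) z = inprod H x z - inprod H y z"
proof -
  have "x = (x \<ominus>\<^bsub>H\<^esub> y) \<oplus>\<^bsub>H\<^esub> y"
    using assms by (simp add: a_minus_def M.a_assoc M.l_neg)
  then show ?thesis
    using inprod_add[of "x \<ominus>\<^bsub>H\<^esub> y" y z] assms by simp
qed

lemma inprod_diff_right:
  assumes "x \<in> carrier H" "y \<in> carrier H" "z \<in> carrier H"
  shows "inprod H z (x \<ominus>\<^bsub>H\<^esub> y) = inprod H z x - inprod H z y"
  by (metis M.minus_closed assms complex_cnj_diff inprod_commute inprod_diff)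

lemma inprod_zero_right [simp]: "x \<in> carrier H \<Longrightarrow> inprod H x \<zero>\<^bsub>H\<^esub> = 0"
  using inprod_commute[of "\<zero>\<^bsub>H\<^esub>" x] by simp

lemmas inprod_linear = inprod_add inprod_add_right inprod_smult inprod_smult_right
  inprod_diff inprod_diff_right

lemma diff_eq_zero_iff:
  assumes "x \<in> carrier H" "y \<in> carrier H"
  shows "x \<ominus>\<^bsub>H\<^esub> y = \<zero>\<^bsub>H\<^esub> \<longleftrightarrow> x = y"
proof
  have "(x \<ominus>\<^bsub>H\<^esub> y) \<oplus>\<^bsub>H\<^esub> y = x"
    using assms by (simp add: a_minus_def M.a_assoc M.l_neg)
  then show "x = y" if "x \<ominus>\<^bsub>H\<^esub> y = \<zero>\<^bsub>H\<^esub>"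
    using that assms by simp
qed (use assms in \<open>simp add: a_minus_def M.r_neg\<close>)

text \<open>
  This turns linear identities between vectors into identities between complex numbers, which
  the rules \<open>inprod_linear\<close> and complex arithmetic decide.
\<close>

lemma vector_eqI:
  assumes "x \<in> carrier H" "y \<in> carrier H"
    and "\<And>z. z \<in> carrier H \<Longrightarrow> inprod H x z = inprod H y z"
  shows "x = y"
proof -
  have "inprod H (x \<ominus>\<^bsub>H\<^esub> y) (x \<ominus>\<^bsub>H\<^esub> y) = 0"
    using assms by (simp add: inprod_diff)
  then have "x \<ominus>\<^bsub>H\<^esub> y = \<zero>\<^bsub>H\<^esub>"
    using assms(1,2) inprod_pos[of "x \<ominus>\<^bsub>H\<^esub> y"] by fastforce
  then show ?thesis
    using assms(1,2) by (simp add: diff_eq_zero_iff)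
qed

lemma hnorm_smult: "x \<in> carrier H \<Longrightarrow> hnorm H (a \<odot>\<^bsub>H\<^esub> x) = cmod a * hnorm H x"
proof -
  assume x: "x \<in> carrier H"
  have "inprod H (a \<odot>\<^bsub>H\<^esub> x) (a \<odot>\<^bsub>H\<^esub> x) = of_real ((cmod a)\<^sup>2) * inprod H x x"
    using x by (simp add: inprod_linear complex_norm_square mult.assoc del: of_real_power)
  then show ?thesis
    by (simp add: hnorm_def real_sqrt_mult)
qed

lemma hnorm_diff_le:
  assumes "x \<in> carrier H" "y \<in> carrier H"
  shows "hnorm H (x \<ominus>\<^bsub>H\<^esub> y) \<le> hnorm H x + hnorm H y"
  using hnorm_triangle[of x "\<ominus>\<^bsub>H\<^esub> y"] assms by (simp add: a_minus_def hnorm_uminus)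

text \<open>
  Rotating \<open>x\<close> by the phase of the inner product makes it real and reduces the claim to
  \<open>Re_inprod_le\<close>.
\<close>

lemma norm_inprod_le:
  assumes "x \<in> carrier H" "y \<in> carrier H"
  shows "cmod (inprod H x y) \<le> hnorm H x * hnorm H y"
proof (cases "inprod H x y = 0")
  case True
  then show ?thesis using assms by (simp add: hnorm_nonneg)
next
  case False
  define a where "a = cnj (sgn (inprod H x y))"
  have "inprod H (a \<odot>\<^bsub>H\<^esub> x) y = of_real (cmod (inprod H x y))"
    using assms False
    by (simp add: inprod_smult a_def sgn_div_norm scaleR_conv_of_real complex_norm_square[symmetric] 
      power2_eq_square mult.commute field_simps)
  moreover have "cmod a = 1"
    using False by (simp add: a_def norm_sgn)
  ultimately show ?thesis
    using Re_inprod_le[of "a \<odot>\<^bsub>H\<^esub> x" y] assms by (simp add: hnorm_smult)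
qed

text \<open>
  The parallelogram law for \<open>x - y\<close> and \<open>x - z\<close>, in the form that makes minimising sequences for
  the distance from \<open>x\<close> to a convex set Cauchy.
\<close>

lemma hnorm_sq_midpoint:
  assumes "x \<in> carrier H" "y \<in> carrier H" "z \<in> carrier H"
  shows "(hnorm H (y \<ominus>\<^bsub>H\<^esub> z))\<^sup>2 = 2 * (hnorm H (x \<ominus>\<^bsub>H\<^esub> y))\<^sup>2 + 2 * (hnorm H (x \<ominus>\<^bsub>H\<^esub> z))\<^sup>2
    - 4 * (hnorm H (x \<ominus>\<^bsub>H\<^esub> ((1/2) \<odot>\<^bsub>H\<^esub> (y \<oplus>\<^bsub>H\<^esub> z))))\<^sup>2"
  using assms by (simp add: hnorm_sq inprod_linear algebra_simps)

abbreviation converges_to :: "(nat \<Rightarrow> 'h) \<Rightarrow> 'h \<Rightarrow> bool" where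
  "converges_to s l \<equiv> (\<lambda>n. hnorm H (s n \<ominus>\<^bsub>H\<^esub> l)) \<longlonglongrightarrow> 0"

lemma tendsto_inprod:
  assumes "\<And>n. s n \<in> carrier H" "l \<in> carrier H" "z \<in> carrier H" "converges_to s l"
  shows "(\<lambda>n. inprod H (s n) z) \<longlonglongrightarrow> inprod H l z"
proof -
  have "(\<lambda>n. inprod H (s n) z - inprod H l z) \<longlonglongrightarrow> 0"
  proof (rule Lim_null_comparison)
    show "\<forall>\<^sub>F n in sequentially. norm (inprod H (s n) z - inprod H l z) \<le> hnorm H (s n \<ominus>\<^bsub>H\<^esub> l) * hnorm H z"
      using norm_inprod_le[of "s _ \<ominus>\<^bsub>H\<^esub> l" z] assms by (simp add: inprod_diff)
    show "(\<lambda>n. hnorm H (s n \<ominus>\<^bsub>H\<^esub> l) * hnorm H z) \<longlonglongrightarrow> 0"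
      using tendsto_mult_right[OF assms(4), of "hnorm H z"] by simp
  qed
  then show ?thesis
    by (simp add: LIM_zero_iff)
qed

lemma limitin_htop_iff:
  assumes "\<And>n. s n \<in> carrier H"
  shows "limitin (htop H) s l sequentially \<longleftrightarrow> l \<in> carrier H \<and> converges_to s l"
  using assms by (auto simp: limitin_metric_dist_null hdist_def)


lemma closed_subspaceD:
  assumes "closed_subspace H N"
  shows "N \<subseteq> carrier H" "\<zero>\<^bsub>H\<^esub> \<in> N"
    and "\<And>x y. x \<in> N \<Longrightarrow> y \<in> N \<Longrightarrow> x \<oplus>\<^bsub>H\<^esub> y \<in> N"
    and "\<And>a x. x \<in> N \<Longrightarrow> a \<odot>\<^bsub>H\<^esub> x \<in> N"
    and "\<And>x y. x \<in> N \<Longrightarrow> y \<in> N \<Longrightarrow> x \<ominus>\<^bsub>H\<^esub> y \<in> N"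
    and "\<And>s l. (\<And>n. s n \<in> N) \<Longrightarrow> l \<in> carrier H \<Longrightarrow> converges_to s l \<Longrightarrow> l \<in> N"
proof -
  interpret submodule N complex_field H
    using assms by (simp add: closed_subspace_def)
  show sub: "N \<subseteq> carrier H" using subset by simp
  show "\<zero>\<^bsub>H\<^esub> \<in> N" using one_closed by simp
  show add: "\<And>x y. x \<in> N \<Longrightarrow> y \<in> N \<Longrightarrow> x \<oplus>\<^bsub>H\<^esub> y \<in> N" using m_closed by simp
  show smult: "\<And>a x. x \<in> N \<Longrightarrow> a \<odot>\<^bsub>H\<^esub> x \<in> N" using smult_closed by simp
  show "x \<ominus>\<^bsub>H\<^esub> y \<in> N" if "x \<in> N" "y \<in> N" for x y
  proof -
    have "x \<ominus>\<^bsub>H\<^esub> y = x \<oplus>\<^bsub>H\<^esub> (-1) \<odot>\<^bsub>H\<^esub> y"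
      using that sub by (intro vector_eqI) (auto simp: inprod_linear subset_iff)
    then show ?thesis using add smult that by simp
  qed
  show "l \<in> N" if s: "\<And>n. s n \<in> N" and "l \<in> carrier H" "converges_to s l" for s l
  proof -
    have "limitin (htop H) s l sequentially"
      using that sub by (subst limitin_htop_iff) auto
    then show ?thesis
      using assms s unfolding closed_subspace_def metric_closedin_iff_sequentially_closed by blast
  qed
qed

lemma closed_subspaceI:
  assumes "N \<subseteq> carrier H" "\<zero>\<^bsub>H\<^esub> \<in> N"
    and "\<And>x y. x \<in> N \<Longrightarrow> y \<in> N \<Longrightarrow> x \<oplus>\<^bsub>H\<^esub> y \<in> N"
    and smult: "\<And>a x. x \<in> N \<Longrightarrow> a \<odot>\<^bsub>H\<^esub> x \<in> N"
    and lim: "\<And>s l. (\<And>n. s n \<in> N) \<Longrightarrow> l \<in> carrier H \<Longrightarrow> converges_to s l \<Longrightarrow> l \<in> N"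
  shows "closed_subspace H N"
  unfolding closed_subspace_def metric_closedin_iff_sequentially_closed
proof (intro conjI allI impI submoduleI)
  fix x assume "x \<in> N"
  moreover have "\<ominus>\<^bsub>H\<^esub> x = (-1) \<odot>\<^bsub>H\<^esub> x"
    using calculation assms(1) inprod_diff[of "\<zero>\<^bsub>H\<^esub>" x] 
    by (intro vector_eqI) (auto simp: inprod_smult a_minus_def subset_iff)
  ultimately show "\<ominus>\<^bsub>H\<^esub> x \<in> N" using smult by simp
next
  fix s l assume *: "range s \<subseteq> N \<and> limitin (htop H) s l sequentially"
  then have "\<And>n. s n \<in> carrier H" using assms(1) by auto
  then have "l \<in> carrier H" "converges_to s l"
    using * limitin_htop_iff[of s l] by blast+
  then show "l \<in> N"
    using * lim[of s l] by blast
qed (use assms in auto)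

lemma orth_compl_diff:
  assumes "x \<in> orth_compl H N" "y \<in> orth_compl H N" "N \<subseteq> carrier H"
  shows "x \<ominus>\<^bsub>H\<^esub> y \<in> orth_compl H N"
  using assms by (auto simp: orth_compl_def inprod_diff subset_iff)

end

section \<open>Orthogonal projection and Riesz representation\<close>

context hilbert_space
begin

lemma Cauchy_converges:
  assumes s: "\<And>n. s n \<in> carrier H"
    and Cauchy: "\<And>e. e > 0 \<Longrightarrow> \<exists>n0. \<forall>m\<ge>n0. \<forall>n\<ge>n0. hnorm H (s m \<ominus>\<^bsub>H\<^esub> s n) < e"
  obtains l where "l \<in> carrier H" "converges_to s l"
proof -
  have "MCauchy s"
    using assms by (fastforce simp: MCauchy_def hdist_def)
  then obtain l where "limitin mtopology s l sequentially"
    using complete by (auto simp: mcomplete_def)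
  then show ?thesis
    using that s limitin_htop_iff by blast
qed

text \<open>
  A sequence in \<open>N\<close> that minimises the distance to \<open>x\<close> is Cauchy by the parallelogram law. Its limit
  \<open>p\<close> realises the distance, and minimality along every line \<open>p + t y\<close> in \<open>N\<close> forces \<open>x - p\<close> to be
  orthogonal to \<open>y\<close>.
\<close>

theorem projection:
  assumes N: "closed_subspace H N" and x: "x \<in> carrier H"
  obtains p where "p \<in> N" "x \<ominus>\<^bsub>H\<^esub> p \<in> orth_compl H N"
proof -
  note N' = closed_subspaceD[OF N]
  have Nc [simp]: "y \<in> carrier H" if "y \<in> N" for y using that N'(1) by auto
  let ?D = "(\<lambda>y. (hnorm H (x \<ominus>\<^bsub>H\<^esub> y))\<^sup>2) ` N"
  define d where "d = Inf ?D"
  have bdd: "bdd_below ?D" by (rule bdd_belowI[of _ 0]) auto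
  have d_le: "d \<le> (hnorm H (x \<ominus>\<^bsub>H\<^esub> y))\<^sup>2" if "y \<in> N" for y
    unfolding d_def using that bdd by (auto intro: cInf_lower)
  have "\<exists>y\<in>N. (hnorm H (x \<ominus>\<^bsub>H\<^esub> y))\<^sup>2 < d + 1 / real (Suc n)" for n
    using cInf_lessD[of ?D "d + 1 / real (Suc n)"] N'(2) unfolding d_def by auto
  then obtain s where sN: "s n \<in> N" and s_less: "(hnorm H (x \<ominus>\<^bsub>H\<^esub> s n))\<^sup>2 < d + 1 / real (Suc n)" for n
    by metis
  have sc [simp]: "s n \<in> carrier H" for n using sN by simp
  have dist: "(hnorm H (s m \<ominus>\<^bsub>H\<^esub> s n))\<^sup>2 \<le> 2 / real (Suc m) + 2 / real (Suc n)" for m n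
    using hnorm_sq_midpoint[OF x, of "s m" "s n"] s_less[of m] s_less[of n]
      d_le[of "(1/2) \<odot>\<^bsub>H\<^esub> (s m \<oplus>\<^bsub>H\<^esub> s n)"] N'(3,4) sN by simp
  obtain p where p: "p \<in> carrier H" "converges_to s p"
  proof (rule Cauchy_converges[of s])
    fix e :: real assume e: "e > 0"
    obtain n0 where n0: "4 / e\<^sup>2 < real n0" using reals_Archimedean2 by blast
    have "hnorm H (s m \<ominus>\<^bsub>H\<^esub> s n) < e" if "m \<ge> n0" "n \<ge> n0" for m n
    proof (rule power2_less_imp_less)
      have less: "2 / real (Suc k) < e\<^sup>2 / 2" if "k \<ge> n0" for k
      proof -
        have "4 / e\<^sup>2 < real (Suc k)" using n0 that by simp
        then show ?thesis using e by (simp add: field_simps)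
      qed
      show "(hnorm H (s m \<ominus>\<^bsub>H\<^esub> s n))\<^sup>2 < e\<^sup>2"
        using dist[of m n] less[OF that(1)] less[OF that(2)] by simp
    qed (use e in simp)
    then show "\<exists>n0. \<forall>m\<ge>n0. \<forall>n\<ge>n0. hnorm H (s m \<ominus>\<^bsub>H\<^esub> s n) < e" by blast
  qed auto
  have pN: "p \<in> N" using N'(6)[of s p] sN p by blast
  have "hnorm H (x \<ominus>\<^bsub>H\<^esub> p) \<le> sqrt (d + 1 / real (Suc n)) + hnorm H (s n \<ominus>\<^bsub>H\<^esub> p)" for n
  proof -
    have "x \<ominus>\<^bsub>H\<^esub> p = (x \<ominus>\<^bsub>H\<^esub> s n) \<oplus>\<^bsub>H\<^esub> (s n \<ominus>\<^bsub>H\<^esub> p)"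
      using x p by (intro vector_eqI) (simp_all add: inprod_linear)
    then have "hnorm H (x \<ominus>\<^bsub>H\<^esub> p) \<le> hnorm H (x \<ominus>\<^bsub>H\<^esub> s n) + hnorm H (s n \<ominus>\<^bsub>H\<^esub> p)"
      using x p hnorm_triangle by simp
    moreover have "hnorm H (x \<ominus>\<^bsub>H\<^esub> s n) \<le> sqrt (d + 1 / real (Suc n))"
      using s_less[of n] by (intro real_le_rsqrt) simp
    ultimately show ?thesis by simp
  qed
  moreover have "(\<lambda>n. sqrt (d + 1 / real (Suc n)) + hnorm H (s n \<ominus>\<^bsub>H\<^esub> p)) \<longlonglongrightarrow> sqrt (d + 0) + 0"
    using LIMSEQ_inverse_real_of_nat
    by (intro tendsto_intros p) (simp add: inverse_eq_divide)
  ultimately have "hnorm H (x \<ominus>\<^bsub>H\<^esub> p) \<le> sqrt d"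
    by (intro LIMSEQ_le_const) auto
  then have p_min: "(hnorm H (x \<ominus>\<^bsub>H\<^esub> p))\<^sup>2 \<le> d"
  proof -
    have "0 \<le> d" unfolding d_def by (rule cInf_greatest) (use N'(2) in auto)
    then show ?thesis
      using power_mono[OF \<open>hnorm H (x \<ominus>\<^bsub>H\<^esub> p) \<le> sqrt d\<close>, of 2] hnorm_nonneg x p by simp
  qed
  have "inprod H (x \<ominus>\<^bsub>H\<^esub> p) y = 0" if y: "y \<in> N" for y
  proof (cases "y = \<zero>\<^bsub>H\<^esub>")
    case True
    then show ?thesis using x p by simp
  next
    case False
    define r where "r = inprod H (x \<ominus>\<^bsub>H\<^esub> p) y"
    define q where "q = Re (inprod H y y)"
    have q: "q > 0" using False y inprod_pos by (simp add: q_def)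
    have yy: "inprod H y y = of_real q" using y inprod_self_real by (simp add: q_def)
    \<comment> \<open>This \<open>t\<close> minimises the distance from \<open>x - p\<close> to the multiples of \<open>y\<close>.\<close>
    define t where "t = r / of_real q"
    have yx: "inprod H y (x \<ominus>\<^bsub>H\<^esub> p) = cnj r"
      using inprod_commute[of "x \<ominus>\<^bsub>H\<^esub> p" y] x p y by (simp add: r_def)
    let ?z = "(x \<ominus>\<^bsub>H\<^esub> p) \<ominus>\<^bsub>H\<^esub> t \<odot>\<^bsub>H\<^esub> y"
    have "?z = x \<ominus>\<^bsub>H\<^esub> (p \<oplus>\<^bsub>H\<^esub> t \<odot>\<^bsub>H\<^esub> y)"
      using x p y by (intro vector_eqI) (simp_all add: inprod_linear)
    then have "(hnorm H (x \<ominus>\<^bsub>H\<^esub> p))\<^sup>2 \<le> (hnorm H ?z)\<^sup>2"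
      using p_min d_le[of "p \<oplus>\<^bsub>H\<^esub> t \<odot>\<^bsub>H\<^esub> y"] pN y N'(3,4) by simp
    also have "(hnorm H ?z)\<^sup>2 = (hnorm H (x \<ominus>\<^bsub>H\<^esub> p))\<^sup>2
        - Re (cnj t * r + t * cnj r - t * cnj t * of_real q)"
    proof -
      have "inprod H ?z ?z = inprod H (x \<ominus>\<^bsub>H\<^esub> p) (x \<ominus>\<^bsub>H\<^esub> p)
          - (cnj t * r + t * cnj r - t * cnj t * of_real q)"
        using x p y yx yy r_def[symmetric]
        by (simp add: inprod_diff[of "x \<ominus>\<^bsub>H\<^esub> p"] inprod_diff_right[of "x \<ominus>\<^bsub>H\<^esub> p"] 
            inprod_smult inprod_smult_right algebra_simps)
      then show ?thesis using x p y by (simp add: hnorm_sq)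
    qed
    also have "cnj t * r + t * cnj r - t * cnj t * of_real q = of_real ((cmod r)\<^sup>2 / q)"
      using q complex_norm_square[of r] by (simp add: t_def field_simps)
    finally have "(cmod r)\<^sup>2 / q \<le> 0" by simp
    then have "r = 0" using q by (simp add: divide_le_0_iff)
    then show ?thesis by (simp add: r_def)
  qed
  then show ?thesis using that pN x p by (auto simp: orth_compl_def)
qed

text \<open>
  The kernel of \<open>\<phi>\<close> is closed. If it is not the whole space, pick \<open>e \<noteq> 0\<close> orthogonal to it; for every
  \<open>x\<close> the vector \<open>\<phi> e x - \<phi> x e\<close> lies in the kernel, and pairing it with \<open>e\<close> computes \<open>\<phi> x\<close>.
\<close>

theorem Riesz_representation:
  assumes add: "\<And>x y. x \<in> carrier H \<Longrightarrow> y \<in> carrier H \<Longrightarrow> \<phi> (x \<oplus>\<^bsub>H\<^esub> y) = \<phi> x + \<phi> y"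
    and smult: "\<And>a x. x \<in> carrier H \<Longrightarrow> \<phi> (a \<odot>\<^bsub>H\<^esub> x) = a * \<phi> x"
    and bound: "\<And>x. x \<in> carrier H \<Longrightarrow> cmod (\<phi> x) \<le> K * hnorm H x"
  obtains z where "z \<in> carrier H" "\<And>x. x \<in> carrier H \<Longrightarrow> \<phi> x = inprod H x z"
proof (cases "\<forall>x\<in>carrier H. \<phi> x = 0")
  case True
  then show ?thesis using that[of "\<zero>\<^bsub>H\<^esub>"] by simp
next
  case False
  then obtain x0 where x0: "x0 \<in> carrier H" "\<phi> x0 \<noteq> 0" by blast
  have diff: "\<phi> (x \<ominus>\<^bsub>H\<^esub> y) = \<phi> x - \<phi> y" if "x \<in> carrier H" "y \<in> carrier H" for x y
  proof -
    have "x = (x \<ominus>\<^bsub>H\<^esub> y) \<oplus>\<^bsub>H\<^esub> y"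
      using that by (intro vector_eqI) (simp_all add: inprod_linear)
    then show ?thesis using add[of "x \<ominus>\<^bsub>H\<^esub> y" y] that by simp
  qed
  have zero: "\<phi> \<zero>\<^bsub>H\<^esub> = 0" using smult[of "\<zero>\<^bsub>H\<^esub>" 0] by simp
  define N where "N = {x \<in> carrier H. \<phi> x = 0}"
  have "closed_subspace H N"
  proof (rule closed_subspaceI)
    show "\<zero>\<^bsub>H\<^esub> \<in> N" using zero by (simp add: N_def)
    fix s l assume s: "\<And>n. s n \<in> N" and l: "l \<in> carrier H" and lim: "converges_to s l"
    have "(\<lambda>n. - \<phi> l) \<longlonglongrightarrow> 0"
    proof (rule Lim_null_comparison)
      show "\<forall>\<^sub>F n in sequentially. norm (- \<phi> l) \<le> K * hnorm H (s n \<ominus>\<^bsub>H\<^esub> l)"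
        using s l bound[of "s _ \<ominus>\<^bsub>H\<^esub> l"] diff[of "s _" l] by (simp add: N_def)
      show "(\<lambda>n. K * hnorm H (s n \<ominus>\<^bsub>H\<^esub> l)) \<longlonglongrightarrow> 0"
        using tendsto_mult_left[OF lim, of K] by simp
    qed
    then show "l \<in> N" using l by (simp add: N_def LIMSEQ_const_iff)
  qed (auto simp: N_def add smult)
  then obtain p where p: "p \<in> N" "x0 \<ominus>\<^bsub>H\<^esub> p \<in> orth_compl H N"
    using projection x0 by blast
  define e where "e = x0 \<ominus>\<^bsub>H\<^esub> p"
  have e: "e \<in> carrier H" "e \<in> orth_compl H N" "\<phi> e \<noteq> 0"
    using p x0 diff[of x0 p] by (auto simp: e_def N_def)
  define q where "q = Re (inprod H e e)"
  have "e \<noteq> \<zero>\<^bsub>H\<^esub>" using e zero by auto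
  then have q: "q > 0" using e inprod_pos by (simp add: q_def)
  have ee: "inprod H e e = of_real q" using e inprod_self_real by (simp add: q_def)
  show ?thesis
  proof (rule that[of "(cnj (\<phi> e) / of_real q) \<odot>\<^bsub>H\<^esub> e"])
    fix x assume x: "x \<in> carrier H"
    let ?y = "\<phi> e \<odot>\<^bsub>H\<^esub> x \<ominus>\<^bsub>H\<^esub> \<phi> x \<odot>\<^bsub>H\<^esub> e"
    have "?y \<in> N" using x e by (simp add: N_def diff smult)
    then have "inprod H e ?y = 0" using e by (simp add: orth_compl_def)
    then have "inprod H ?y e = 0"
      using inprod_commute[of e ?y] x e by simp
    then have "\<phi> x * of_real q = \<phi> e * inprod H x e"
      using x e by (simp add: inprod_linear ee)
    then show "\<phi> x = inprod H x ((cnj (\<phi> e) / complex_of_real q) \<odot>\<^bsub>H\<^esub> e)"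
      using x e q by (simp add: inprod_smult_right field_simps)
  qed (use e in simp)
qed

end

section \<open>Bounded operators as functions\<close>

lemma opnorm_leI:
  assumes "\<And>x y. (x, y) \<in> T \<Longrightarrow> hnorm H x \<le> 1 \<Longrightarrow> hnorm K y \<le> B"
  shows "opnorm H K T \<le> ennreal B"
  unfolding opnorm_def using assms by (auto intro!: SUP_least ennreal_leI)

text \<open>
  Only elements of norm at most 1 enter the operator norm. Dividing by a number slightly larger
  than the norm of \<open>x\<close>, instead of by that norm, also covers vectors \<open>x\<close> of norm 0.
\<close>

lemma (in inner_product_space) hnorm_le_opnorm:
  assumes carrier: "T \<subseteq> carrier H \<times> carrier H"
    and smult: "\<And>a x y. (x, y) \<in> T \<Longrightarrow> (a \<odot>\<^bsub>H\<^esub> x, a \<odot>\<^bsub>H\<^esub> y) \<in> T"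
    and opnorm: "opnorm H H T \<le> ennreal B" and "0 \<le> B"
    and xy: "(x, y) \<in> T"
  shows "hnorm H y \<le> B * hnorm H x"
proof (rule field_le_epsilon)
  fix e :: real assume "e > 0"
  have c [simp]: "x \<in> carrier H" "y \<in> carrier H" using carrier xy by auto
  define t where "t = hnorm H x + e / (B + 1)"
  have t: "0 < t" "hnorm H x \<le> t"
    using \<open>e > 0\<close> \<open>0 \<le> B\<close> hnorm_nonneg[of x] by (simp_all add: t_def add_nonneg_pos)
  let ?a = "complex_of_real (1 / t)"
  have "hnorm H (?a \<odot>\<^bsub>H\<^esub> x) \<le> 1"
    using t by (simp add: hnorm_smult norm_divide)
  then have "ennreal (hnorm H (?a \<odot>\<^bsub>H\<^esub> y)) \<le> opnorm H H T"
    unfolding opnorm_def using smult[OF xy, of ?a] by (intro SUP_upper2[of "(?a \<odot>\<^bsub>H\<^esub> x, ?a \<odot>\<^bsub>H\<^esub> y)"]) auto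
  with opnorm have "ennreal (hnorm H (?a \<odot>\<^bsub>H\<^esub> y)) \<le> ennreal B" by order
  then have "hnorm H (?a \<odot>\<^bsub>H\<^esub> y) \<le> B" using \<open>0 \<le> B\<close> by simp
  then have "hnorm H y \<le> B * t"
    using t by (simp add: hnorm_smult norm_divide field_simps)
  also have "B * (e / (B + 1)) \<le> e"
    using \<open>e > 0\<close> \<open>0 \<le> B\<close> by (simp add: field_simps)
  then have "B * t \<le> B * hnorm H x + e"
    by (simp add: t_def algebra_simps)
  finally show "hnorm H y \<le> B * hnorm H x + e" .
qed

text \<open>
  Everywhere defined operators are easier to handle as functions, which need to be linear on the
  carrier only; \<open>bounded_operator_graph\<close> below passes from graphs to functions.
\<close>

locale bounded_map = inner_product_space H for H :: "'h hilbert" +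
  fixes m :: "'h \<Rightarrow> 'h" and K :: real
  assumes m_closed [simp]: "x \<in> carrier H \<Longrightarrow> m x \<in> carrier H"
    and m_add: "\<lbrakk>x \<in> carrier H; y \<in> carrier H\<rbrakk> \<Longrightarrow> m (x \<oplus>\<^bsub>H\<^esub> y) = m x \<oplus>\<^bsub>H\<^esub> m y"
    and m_smult: "x \<in> carrier H \<Longrightarrow> m (a \<odot>\<^bsub>H\<^esub> x) = a \<odot>\<^bsub>H\<^esub> m x"
    and m_bound: "x \<in> carrier H \<Longrightarrow> hnorm H (m x) \<le> K * hnorm H x"
    and K_nonneg: "0 \<le> K"
begin

lemma m_diff: "\<lbrakk>x \<in> carrier H; y \<in> carrier H\<rbrakk> \<Longrightarrow> m (x \<ominus>\<^bsub>H\<^esub> y) = m x \<ominus>\<^bsub>H\<^esub> m y"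
proof -
  assume xy: "x \<in> carrier H" "y \<in> carrier H"
  have "x = (x \<ominus>\<^bsub>H\<^esub> y) \<oplus>\<^bsub>H\<^esub> y"
    using xy by (intro vector_eqI) (simp_all add: inprod_linear)
  then have "m x = m (x \<ominus>\<^bsub>H\<^esub> y) \<oplus>\<^bsub>H\<^esub> m y"
    using m_add[of "x \<ominus>\<^bsub>H\<^esub> y" y] xy by simp
  then show ?thesis
    using xy by (intro vector_eqI) (simp_all add: inprod_linear)
qed

lemma m_zero: "m \<zero>\<^bsub>H\<^esub> = \<zero>\<^bsub>H\<^esub>"
  using m_bound[of "\<zero>\<^bsub>H\<^esub>"] hnorm_nonneg[of "m \<zero>\<^bsub>H\<^esub>"] hnorm_eq_0[of "m \<zero>\<^bsub>H\<^esub>"] hnorm_eq_0[of "\<zero>\<^bsub>H\<^esub>"]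
  by simp

lemma converges_to_m:
  assumes "\<And>n. s n \<in> carrier H" "l \<in> carrier H" "converges_to s l"
  shows "converges_to (\<lambda>n. m (s n)) (m l)"
proof (rule Lim_null_comparison)
  show "\<forall>\<^sub>F n in sequentially. norm (hnorm H (m (s n) \<ominus>\<^bsub>H\<^esub> m l)) \<le> K * hnorm H (s n \<ominus>\<^bsub>H\<^esub> l)"
    using m_bound[of "s _ \<ominus>\<^bsub>H\<^esub> l"] assms by (simp add: m_diff hnorm_nonneg)
  show "(\<lambda>n. K * hnorm H (s n \<ominus>\<^bsub>H\<^esub> l)) \<longlonglongrightarrow> 0"
    using tendsto_mult_left[OF assms(3), of K] by simp
qed

end

definition graph_on :: "'h hilbert \<Rightarrow> ('h \<Rightarrow> 'h) \<Rightarrow> ('h \<times> 'h) set" where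
  "graph_on H m = {(x, m x) |x. x \<in> carrier H}"

lemma (in inner_product_space) bounded_operator_graph:
  assumes T: "T \<in> bounded_operators H H" and opnorm: "opnorm H H T \<le> ennreal K" and K: "0 \<le> K"
  obtains m where "bounded_map H m K" "T = graph_on H m"
proof -
  have "linear_operator H H T" and dom: "Domain T = carrier H"
    using T by (auto simp: bounded_operators_def)
  then have lin: "T \<subseteq> carrier H \<times> carrier H" "single_valued T"
    "\<And>x y x' y'. (x, y) \<in> T \<Longrightarrow> (x', y') \<in> T \<Longrightarrow> (x \<oplus>\<^bsub>H\<^esub> x', y \<oplus>\<^bsub>H\<^esub> y') \<in> T"
    "\<And>a x y. (x, y) \<in> T \<Longrightarrow> (a \<odot>\<^bsub>H\<^esub> x, a \<odot>\<^bsub>H\<^esub> y) \<in> T"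
    unfolding linear_operator_def by blast+
  from dom have "\<forall>x\<in>carrier H. \<exists>y. (x, y) \<in> T" by blast
  then obtain m where m: "\<And>x. x \<in> carrier H \<Longrightarrow> (x, m x) \<in> T" by metis
  have eq: "y = m x" if "(x, y) \<in> T" for x y
    using single_valuedD[OF lin(2) that m] lin(1) that by blast
  show ?thesis
  proof
    show "T = graph_on H m"
      unfolding graph_on_def using m eq lin(1) by blast
    show "bounded_map H m K"
    proof (unfold_locales, goal_cases)
      case (1 x) then show ?case using m lin(1) by blast
    next
      case (2 x y) then show ?case using lin(3)[OF m m] eq by metis
    next
      case (3 x a) then show ?case using lin(4)[OF m] eq by metis
    next
      case (4 x) then show ?case
        using hnorm_le_opnorm[OF lin(1,4) opnorm K m] by blast
    qed (fact K)
  qed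
qed

lemma (in hilbert_space) adjoint_exists:
  assumes "bounded_map H m K" and y: "y \<in> carrier H"
  obtains z where "z \<in> carrier H" "\<And>x. x \<in> carrier H \<Longrightarrow> inprod H (m x) y = inprod H x z"
proof -
  interpret bounded_map H m K by fact
  show ?thesis
  proof (rule Riesz_representation[of "\<lambda>x. inprod H (m x) y" "K * hnorm H y"])
    fix x assume x: "x \<in> carrier H"
    have "cmod (inprod H (m x) y) \<le> hnorm H (m x) * hnorm H y"
      using x y by (simp add: norm_inprod_le)
    also have "\<dots> \<le> K * hnorm H x * hnorm H y"
      using m_bound[OF x] hnorm_nonneg[OF y] by (rule mult_right_mono)
    finally show "cmod (inprod H (m x) y) \<le> K * hnorm H y * hnorm H x" by (simp add: mult_ac)
  qed (use y that in \<open>auto simp: m_add m_smult inprod_linear\<close>)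
qed

text \<open>
  The real part of an operator, as a graph, relates \<open>x\<close> to something only if \<open>x\<close> is in the domain of
  the adjoint. The lower bound therefore reaches all \<open>x\<close> only because the adjoint is
  everywhere defined.
\<close>

lemma (in hilbert_space) op_Re_coercive:
  assumes "bounded_map H m K" and ge: "op_ge H (op_Re H (graph_on H m)) c" and x: "x \<in> carrier H"
  shows "c * (hnorm H x)\<^sup>2 \<le> Re (inprod H (m x) x)"
proof -
  interpret bounded_map H m K by fact
  obtain z where z: "z \<in> carrier H" "\<And>y. y \<in> carrier H \<Longrightarrow> inprod H (m y) x = inprod H y z"
    using adjoint_exists[OF assms(1) x] by blast
  have "(x, z) \<in> op_adjoint H H (graph_on H m)"
    using x z by (auto simp: op_adjoint_def graph_on_def)
  then have "(x, (1/2) \<odot>\<^bsub>H\<^esub> (m x \<oplus>\<^bsub>H\<^esub> z)) \<in> op_Re H (graph_on H m)"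
    using x unfolding op_Re_def op_plus_def op_scale_def graph_on_def by blast
  then have "c * (hnorm H x)\<^sup>2 \<le> Re (inprod H ((1/2) \<odot>\<^bsub>H\<^esub> (m x \<oplus>\<^bsub>H\<^esub> z)) x)"
    using ge by (auto simp: op_ge_def)
  also have "\<dots> = Re (inprod H (m x) x)"
    using x z inprod_commute[of x z] by (simp add: inprod_linear)
  finally show ?thesis .
qed

section \<open>Bounded invertibility of a coercive plus a skew-selfadjoint operator\<close>

locale accretive_problem = hilbert_space H + bounded_map H m K
  for H :: "'h hilbert" and m :: "'h \<Rightarrow> 'h" and K :: real +
  fixes c :: real and A :: "('h \<times> 'h) set"
  assumes c_pos: "0 < c"
    and coercive: "x \<in> carrier H \<Longrightarrow> c * (hnorm H x)\<^sup>2 \<le> Re (inprod H (m x) x)"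
    and linear_A: "linear_operator H H A"
    and skew: "A = op_scale H (-1) (op_adjoint H H A)"
begin

lemma A_carrier: "(x, y) \<in> A \<Longrightarrow> x \<in> carrier H" "(x, y) \<in> A \<Longrightarrow> y \<in> carrier H"
  using linear_A by (auto simp: linear_operator_def)

lemma A_zero: "(\<zero>\<^bsub>H\<^esub>, \<zero>\<^bsub>H\<^esub>) \<in> A"
  using linear_A by (auto simp: linear_operator_def)

lemma A_add: "(x, y) \<in> A \<Longrightarrow> (x', y') \<in> A \<Longrightarrow> (x \<oplus>\<^bsub>H\<^esub> x', y \<oplus>\<^bsub>H\<^esub> y') \<in> A"
  using linear_A unfolding linear_operator_def by blast

lemma A_smult: "(x, y) \<in> A \<Longrightarrow> (a \<odot>\<^bsub>H\<^esub> x, a \<odot>\<^bsub>H\<^esub> y) \<in> A"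
  using linear_A unfolding linear_operator_def by blast

lemma A_diff:
  assumes "(x, y) \<in> A" "(x', y') \<in> A"
  shows "(x \<ominus>\<^bsub>H\<^esub> x', y \<ominus>\<^bsub>H\<^esub> y') \<in> A"
proof -
  have "z \<ominus>\<^bsub>H\<^esub> z' = z \<oplus>\<^bsub>H\<^esub> (-1) \<odot>\<^bsub>H\<^esub> z'" if "z \<in> carrier H" "z' \<in> carrier H" for z z'
    using that by (intro vector_eqI) (simp_all add: inprod_linear)
  then show ?thesis
    using A_add[OF assms(1) A_smult[OF assms(2), of "-1"]] assms A_carrier by metis
qed

text \<open>
  The equation \<open>A = -A\<^sup>*\<close> is used through \<open>skewD\<close>, which is skew-symmetry, and \<open>skewI\<close>, which says that
  the domain of \<open>A\<close> is as large as skew-symmetry permits.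
\<close>

lemma skewD:
  assumes "(x, y) \<in> A" "(x', w) \<in> A"
  shows "inprod H w x = - inprod H x' y"
proof -
  obtain z where "y = (-1) \<odot>\<^bsub>H\<^esub> z" "(x, z) \<in> op_adjoint H H A"
    using assms(1) by (subst (asm) skew) (auto simp: op_scale_def)
  then show ?thesis
    using assms(2) A_carrier[OF assms(2)] by (auto simp: op_adjoint_def inprod_linear)
qed

lemma skewI:
  assumes "x \<in> carrier H" "y \<in> carrier H"
    and "\<And>x' w. (x', w) \<in> A \<Longrightarrow> inprod H w x = - inprod H x' y"
  shows "(x, y) \<in> A"
proof -
  have "(x, (-1) \<odot>\<^bsub>H\<^esub> y) \<in> op_adjoint H H A"
    using assms A_carrier by (auto simp: op_adjoint_def inprod_linear)
  moreover have "y = (-1) \<odot>\<^bsub>H\<^esub> ((-1) \<odot>\<^bsub>H\<^esub> y)"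
    using assms(2) by (intro vector_eqI) (simp_all add: inprod_linear)
  ultimately show ?thesis
    by (subst skew) (auto simp: op_scale_def)
qed

lemma Re_inprod_A:
  assumes "(x, y) \<in> A"
  shows "Re (inprod H y x) = 0"
  using skewD[OF assms assms] inprod_commute[of x y] A_carrier[OF assms]
  by (simp add: complex_eq_iff)

abbreviation B :: "real \<Rightarrow> ('h \<times> 'h) set" where
  "B \<epsilon> \<equiv> B_op H (graph_on H m) A \<epsilon>"

lemma B_iff:
  "(x, f) \<in> B \<epsilon> \<longleftrightarrow> (\<exists>y. (x, y) \<in> A \<and> f = m x \<oplus>\<^bsub>H\<^esub> complex_of_real (1 / \<epsilon>) \<odot>\<^bsub>H\<^esub> y)"
  using A_carrier by (auto simp: B_op_def op_plus_def op_scale_def graph_on_def)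

lemma B_carrier:
  assumes "(x, f) \<in> B \<epsilon>"
  shows "x \<in> carrier H" "f \<in> carrier H"
  using assms A_carrier unfolding B_iff by auto

lemma B_zero: "(\<zero>\<^bsub>H\<^esub>, \<zero>\<^bsub>H\<^esub>) \<in> B \<epsilon>"
  unfolding B_iff using A_zero by (intro exI[of _ "\<zero>\<^bsub>H\<^esub>"]) (simp add: m_zero)

lemma B_add:
  assumes "(x, f) \<in> B \<epsilon>" "(x', f') \<in> B \<epsilon>"
  shows "(x \<oplus>\<^bsub>H\<^esub> x', f \<oplus>\<^bsub>H\<^esub> f') \<in> B \<epsilon>"
proof -
  obtain y y' where y: "(x, y) \<in> A" "f = m x \<oplus>\<^bsub>H\<^esub> complex_of_real (1 / \<epsilon>) \<odot>\<^bsub>H\<^esub> y"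
    "(x', y') \<in> A" "f' = m x' \<oplus>\<^bsub>H\<^esub> complex_of_real (1 / \<epsilon>) \<odot>\<^bsub>H\<^esub> y'"
    using assms unfolding B_iff by blast
  note [simp] = A_carrier[OF y(1)] A_carrier[OF y(3)]
  have "f \<oplus>\<^bsub>H\<^esub> f' = m (x \<oplus>\<^bsub>H\<^esub> x') \<oplus>\<^bsub>H\<^esub> complex_of_real (1 / \<epsilon>) \<odot>\<^bsub>H\<^esub> (y \<oplus>\<^bsub>H\<^esub> y')"
    unfolding y(2,4) by (intro vector_eqI) (simp_all add: inprod_linear m_add algebra_simps)
  then show ?thesis
    unfolding B_iff using A_add[OF y(1,3)] by blast
qed

lemma B_smult:
  assumes "(x, f) \<in> B \<epsilon>"
  shows "(a \<odot>\<^bsub>H\<^esub> x, a \<odot>\<^bsub>H\<^esub> f) \<in> B \<epsilon>"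
proof -
  obtain y where y: "(x, y) \<in> A" "f = m x \<oplus>\<^bsub>H\<^esub> complex_of_real (1 / \<epsilon>) \<odot>\<^bsub>H\<^esub> y"
    using assms unfolding B_iff by blast
  note [simp] = A_carrier[OF y(1)]
  have "a \<odot>\<^bsub>H\<^esub> f = m (a \<odot>\<^bsub>H\<^esub> x) \<oplus>\<^bsub>H\<^esub> complex_of_real (1 / \<epsilon>) \<odot>\<^bsub>H\<^esub> (a \<odot>\<^bsub>H\<^esub> y)"
    unfolding y(2) by (intro vector_eqI) (simp_all add: inprod_linear m_smult algebra_simps)
  then show ?thesis
    unfolding B_iff using A_smult[OF y(1)] by blast
qed

lemma B_diff:
  assumes "(x, f) \<in> B \<epsilon>" "(x', f') \<in> B \<epsilon>"
  shows "(x \<ominus>\<^bsub>H\<^esub> x', f \<ominus>\<^bsub>H\<^esub> f') \<in> B \<epsilon>"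
proof -
  have "z \<ominus>\<^bsub>H\<^esub> z' = z \<oplus>\<^bsub>H\<^esub> (-1) \<odot>\<^bsub>H\<^esub> z'" if "z \<in> carrier H" "z' \<in> carrier H" for z z'
    using that by (intro vector_eqI) (simp_all add: inprod_linear)
  then show ?thesis
    using B_add[OF assms(1) B_smult[OF assms(2), of "-1"]] B_carrier[OF assms(1)] B_carrier[OF assms(2)]
    by metis
qed

text \<open>The term \<open>A / \<epsilon>\<close> contributes nothing to the real part, so the bound is uniform in \<open>\<epsilon>\<close>.\<close>

lemma B_coercive:
  assumes "(x, f) \<in> B \<epsilon>"
  shows "c * (hnorm H x)\<^sup>2 \<le> Re (inprod H f x)"
proof -
  obtain y where y: "(x, y) \<in> A" "f = m x \<oplus>\<^bsub>H\<^esub> complex_of_real (1 / \<epsilon>) \<odot>\<^bsub>H\<^esub> y"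
    using assms unfolding B_iff by blast
  then show ?thesis
    using coercive[of x] Re_inprod_A[OF y(1)] A_carrier[OF y(1)]
    by (simp add: inprod_linear)
qed

lemma B_lower_bound:
  assumes "(x, f) \<in> B \<epsilon>"
  shows "c * hnorm H x \<le> hnorm H f"
proof (cases "hnorm H x = 0")
  case True
  then show ?thesis using B_carrier[OF assms] hnorm_nonneg by simp
next
  case False
  then have "hnorm H x > 0"
    using hnorm_nonneg B_carrier[OF assms] by (simp add: order_less_le)
  moreover have "c * hnorm H x * hnorm H x \<le> hnorm H f * hnorm H x"
    using B_coercive[OF assms] Re_inprod_le[of f x] B_carrier[OF assms]
    by (simp add: power2_eq_square mult.assoc)
  ultimately show ?thesis by simp
qed

text \<open>
  If \<open>s n = B (x n)\<close> converges to \<open>l\<close>, the lower bound for \<open>B\<close> makes \<open>x\<close> a Cauchy sequence. Its limit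
  \<open>p\<close> is in the domain of \<open>A\<close>, because by \<open>skewI\<close> membership in \<open>A\<close> is a family of identities between
  inner products, which survive the limit.
\<close>

lemma closed_Range_B:
  assumes "\<epsilon> > 0"
  shows "closed_subspace H (Range (B \<epsilon>))"
proof (rule closed_subspaceI)
  fix s l
  assume "\<And>n. s n \<in> Range (B \<epsilon>)" and l: "l \<in> carrier H" and lim: "converges_to s l"
  then have "\<forall>n. \<exists>x. (x, s n) \<in> B \<epsilon>" by blast
  then obtain x where xB: "(x n, s n) \<in> B \<epsilon>" for n by metis
  then have "\<forall>n. \<exists>y. (x n, y) \<in> A \<and> s n = m (x n) \<oplus>\<^bsub>H\<^esub> complex_of_real (1 / \<epsilon>) \<odot>\<^bsub>H\<^esub> y"
    unfolding B_iff by blast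
  then obtain y where y: "(x n, y n) \<in> A"
    and s: "s n = m (x n) \<oplus>\<^bsub>H\<^esub> complex_of_real (1 / \<epsilon>) \<odot>\<^bsub>H\<^esub> y n" for n by metis
  have [simp]: "x n \<in> carrier H" "y n \<in> carrier H" "s n \<in> carrier H" for n
    using A_carrier[OF y] B_carrier[OF xB] by auto
  obtain p where p: "p \<in> carrier H" "converges_to x p"
  proof (rule Cauchy_converges[of x])
    fix e :: real assume e: "e > 0"
    have "0 < c * e / 2" using e c_pos by simp
    then obtain n0 where n0: "\<And>n. n \<ge> n0 \<Longrightarrow> hnorm H (s n \<ominus>\<^bsub>H\<^esub> l) < c * e / 2"
      using order_tendstoD(2)[OF lim] unfolding eventually_sequentially by blast
    have "hnorm H (x i \<ominus>\<^bsub>H\<^esub> x j) < e" if "i \<ge> n0" "j \<ge> n0" for i j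
    proof -
      have "s i \<ominus>\<^bsub>H\<^esub> s j = (s i \<ominus>\<^bsub>H\<^esub> l) \<ominus>\<^bsub>H\<^esub> (s j \<ominus>\<^bsub>H\<^esub> l)"
        using l by (intro vector_eqI) (simp_all add: inprod_diff)
      then have "hnorm H (s i \<ominus>\<^bsub>H\<^esub> s j) \<le> hnorm H (s i \<ominus>\<^bsub>H\<^esub> l) + hnorm H (s j \<ominus>\<^bsub>H\<^esub> l)"
        using l hnorm_diff_le[of "s i \<ominus>\<^bsub>H\<^esub> l" "s j \<ominus>\<^bsub>H\<^esub> l"] by simp
      then have "c * hnorm H (x i \<ominus>\<^bsub>H\<^esub> x j) < c * e"
        using B_lower_bound[OF B_diff[OF xB xB], of i j] n0[OF that(1)] n0[OF that(2)] by simp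
      then show ?thesis using c_pos by simp
    qed
    then show "\<exists>n0. \<forall>m\<ge>n0. \<forall>n\<ge>n0. hnorm H (x m \<ominus>\<^bsub>H\<^esub> x n) < e" by blast
  qed auto
  \<comment> \<open>The value that \<open>A p\<close> must have for \<open>B p = l\<close> to hold.\<close>
  define q where "q = complex_of_real \<epsilon> \<odot>\<^bsub>H\<^esub> (l \<ominus>\<^bsub>H\<^esub> m p)"
  have q: "q \<in> carrier H" using l p by (simp add: q_def)
  have "(p, q) \<in> A"
  proof (rule skewI[OF p(1) q])
    fix x' w assume xw: "(x', w) \<in> A"
    note [simp] = A_carrier[OF xw]
    have "inprod H (x n) w = - complex_of_real \<epsilon> * (inprod H (s n) x' - inprod H (m (x n)) x')" for n
      using skewD[OF xw y[of n]] assms by (simp add: s inprod_linear)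
    then have "(\<lambda>n. inprod H (x n) w)
        \<longlonglongrightarrow> - complex_of_real \<epsilon> * (inprod H l x' - inprod H (m p) x')"
      using lim l p converges_to_m[OF _ p] by (auto intro!: tendsto_intros tendsto_inprod)
    moreover have "(\<lambda>n. inprod H (x n) w) \<longlonglongrightarrow> inprod H p w"
      using p by (intro tendsto_inprod) auto
    ultimately have "inprod H p w = - inprod H q x'"
      using LIMSEQ_unique l p by (fastforce simp: q_def inprod_linear)
    then show "inprod H w p = - inprod H x' q"
      using inprod_commute[of p w] inprod_commute[of q x'] p q by simp
  qed
  moreover have "l = m p \<oplus>\<^bsub>H\<^esub> complex_of_real (1 / \<epsilon>) \<odot>\<^bsub>H\<^esub> q"
    using l p assms by (intro vector_eqI) (simp_all add: q_def inprod_linear)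
  ultimately show "l \<in> Range (B \<epsilon>)"
    unfolding Range_iff B_iff by blast
next
  show "Range (B \<epsilon>) \<subseteq> carrier H" using B_carrier by blast
qed (use B_zero B_add B_smult in blast)+

text \<open>
  A vector \<open>e\<close> orthogonal to the range satisfies \<open>\<langle>A x, e\<rangle> = -\<epsilon> \<langle>x, m\<^sup>* e\<rangle>\<close> for all \<open>x\<close> in the domain, hence
  lies in the domain of \<open>A\<close> by \<open>skewI\<close>. Then \<open>B e\<close> is defined and orthogonal to \<open>e\<close>, and coercivity
  gives \<open>e = 0\<close>.
\<close>

lemma Range_B:
  assumes "\<epsilon> > 0"
  shows "Range (B \<epsilon>) = carrier H"
proof
  show "Range (B \<epsilon>) \<subseteq> carrier H" using B_carrier by blast
  show "carrier H \<subseteq> Range (B \<epsilon>)"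
  proof
    fix f assume f: "f \<in> carrier H"
    obtain p where p: "p \<in> Range (B \<epsilon>)" "f \<ominus>\<^bsub>H\<^esub> p \<in> orth_compl H (Range (B \<epsilon>))"
      using projection[OF closed_Range_B[OF assms] f] by blast
    define e where "e = f \<ominus>\<^bsub>H\<^esub> p"
    have pc: "p \<in> carrier H" using p B_carrier by blast
    have e: "e \<in> carrier H" and orth: "\<And>x g. (x, g) \<in> B \<epsilon> \<Longrightarrow> inprod H g e = 0"
    proof -
      show ec: "e \<in> carrier H" using f pc by (simp add: e_def)
      show "inprod H g e = 0" if "(x, g) \<in> B \<epsilon>" for x g
        using p(2) that inprod_commute[of e g] ec B_carrier[OF that]
        by (auto simp: orth_compl_def e_def[symmetric])
    qed
    \<comment> \<open>\<open>z\<close> is \<open>m\<^sup>* e\<close>.\<close>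
    obtain z where z: "z \<in> carrier H" "\<And>x. x \<in> carrier H \<Longrightarrow> inprod H (m x) e = inprod H x z"
      using adjoint_exists[OF bounded_map_axioms e] by blast
    have "(e, complex_of_real \<epsilon> \<odot>\<^bsub>H\<^esub> z) \<in> A"
    proof (rule skewI)
      fix x' w assume xw: "(x', w) \<in> A"
      note [simp] = A_carrier[OF xw]
      have "inprod H (m x' \<oplus>\<^bsub>H\<^esub> complex_of_real (1 / \<epsilon>) \<odot>\<^bsub>H\<^esub> w) e = 0"
        using xw by (intro orth) (auto simp: B_iff)
      then have "inprod H x' z + inprod H w e / complex_of_real \<epsilon> = 0"
        using e z by (simp add: inprod_linear)
      then show "inprod H w e = - inprod H x' (complex_of_real \<epsilon> \<odot>\<^bsub>H\<^esub> z)"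
        using z assms by (simp add: inprod_linear field_simps add_eq_0_iff)
    qed (use e z in auto)
    then obtain g where "(e, g) \<in> B \<epsilon>" unfolding B_iff by blast
    then have "c * (hnorm H e)\<^sup>2 \<le> 0"
      using B_coercive orth by fastforce
    then have "e = \<zero>\<^bsub>H\<^esub>"
      using c_pos e hnorm_eq_0[of e] by (simp add: mult_le_0_iff)
    then have "f = p"
      using f pc by (simp add: e_def diff_eq_zero_iff)
    then show "f \<in> Range (B \<epsilon>)" using p by simp
  qed
qed

theorem B_boundedly_invertible:
  assumes "\<epsilon> > 0"
  shows "boundedly_invertible H H (B \<epsilon>)"
proof -
  have "x = x'" if "(x, f) \<in> B \<epsilon>" "(x', f) \<in> B \<epsilon>" for x x' f
  proof -
    have "c * hnorm H (x \<ominus>\<^bsub>H\<^esub> x') \<le> hnorm H (f \<ominus>\<^bsub>H\<^esub> f)"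
      using B_lower_bound[OF B_diff[OF that]] .
    also have "f \<ominus>\<^bsub>H\<^esub> f = \<zero>\<^bsub>H\<^esub>" using B_carrier[OF that(1)] by (simp add: diff_eq_zero_iff)
    finally have "c * hnorm H (x \<ominus>\<^bsub>H\<^esub> x') \<le> 0"
      using hnorm_eq_0[of "\<zero>\<^bsub>H\<^esub>"] by simp
    then have "hnorm H (x \<ominus>\<^bsub>H\<^esub> x') = 0"
      using c_pos hnorm_nonneg[of "x \<ominus>\<^bsub>H\<^esub> x'"] B_carrier[OF that(1)] B_carrier[OF that(2)]
      by (simp add: mult_le_0_iff)
    then show ?thesis
      using B_carrier[OF that(1)] B_carrier[OF that(2)] hnorm_eq_0[of "x \<ominus>\<^bsub>H\<^esub> x'"]
      by (simp add: diff_eq_zero_iff)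
  qed
  then have "single_valued ((B \<epsilon>)\<inverse>)" by (auto simp: single_valued_def)
  then have "linear_operator H H ((B \<epsilon>)\<inverse>)"
    unfolding linear_operator_def using B_carrier B_zero B_add B_smult by blast
  moreover have "opnorm H H ((B \<epsilon>)\<inverse>) \<le> ennreal (1 / c)"
  proof (rule opnorm_leI)
    fix f x assume "(f, x) \<in> (B \<epsilon>)\<inverse>" "hnorm H f \<le> 1"
    then show "hnorm H x \<le> 1 / c"
      using B_lower_bound[of x f \<epsilon>] c_pos by (simp add: field_simps)
  qed
  then have "opnorm H H ((B \<epsilon>)\<inverse>) < \<infinity>"
    using ennreal_less_top le_less_trans by (metis infinity_ennreal_def)
  ultimately show ?thesis
    using Range_B[OF assms] by (simp add: boundedly_invertible_def bounded_operators_def)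
qed

end


section \<open>Orthogonal projections as graphs\<close>

context inner_product_space
begin

lemma op_embed_adj_iff:
  "(x, p) \<in> op_embed_adj H N \<longleftrightarrow> x \<in> carrier H \<and> p \<in> N \<and> (\<forall>y\<in>N. inprod H y x = inprod H y p)"
  by (auto simp: op_embed_adj_def op_adjoint_def op_embed_def)

lemma op_proj_eq_embed_adj: "op_proj H N = op_embed_adj H N"
  by (auto simp: op_proj_def op_embed_def op_embed_adj_iff)

lemma op_proj_iff:
  assumes "N \<subseteq> carrier H"
  shows "(x, p) \<in> op_proj H N \<longleftrightarrow> x \<in> carrier H \<and> p \<in> N \<and> x \<ominus>\<^bsub>H\<^esub> p \<in> orth_compl H N"
proof -
  have "inprod H (x \<ominus>\<^bsub>H\<^esub> p) y = 0 \<longleftrightarrow> inprod H y x = inprod H y p"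
    if "x \<in> carrier H" "p \<in> N" "y \<in> N" for y
    using that assms inprod_diff_right[of x p y] inprod_commute[of "x \<ominus>\<^bsub>H\<^esub> p" y] by (auto simp: subset_iff)
  then show ?thesis
    using assms by (auto simp: op_proj_eq_embed_adj op_embed_adj_iff orth_compl_def subset_iff)
qed

lemma inprod_orth_compl:
  assumes "N \<subseteq> carrier H" "x \<in> N" "r \<in> orth_compl H N"
  shows "inprod H r x = 0" "inprod H x r = 0"
  using assms inprod_commute[of r x] by (auto simp: orth_compl_def)

text \<open>
  Elements of \<open>N\<^sup>\<bottom>\<close> have the same inner product with \<open>p + r\<close> as with \<open>r\<close>, and \<open>r\<close> is the only vector of
  \<open>N\<^sup>\<bottom>\<close> with these inner products.
\<close>

lemma op_proj_orth_compl:
  assumes N: "N \<subseteq> carrier H" and p: "p \<in> N" and r: "r \<in> orth_compl H N"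
  shows "(p \<oplus>\<^bsub>H\<^esub> r, q) \<in> op_proj H (orth_compl H N) \<longleftrightarrow> q = r"
proof
  have [simp]: "p \<in> carrier H" "r \<in> carrier H" using p r N by (auto simp: orth_compl_def)
  have orth: "inprod H y p = 0" if "y \<in> orth_compl H N" for y
    using that p by (simp add: orth_compl_def)
  have yc: "y \<in> carrier H" if "y \<in> orth_compl H N" for y
    using that by (simp add: orth_compl_def)
  show "(p \<oplus>\<^bsub>H\<^esub> r, q) \<in> op_proj H (orth_compl H N)" if "q = r"
    using that r yc orth by (simp add: op_proj_eq_embed_adj op_embed_adj_iff inprod_add_right)
  assume "(p \<oplus>\<^bsub>H\<^esub> r, q) \<in> op_proj H (orth_compl H N)"
  then have q: "q \<in> orth_compl H N"
    "\<And>y. y \<in> orth_compl H N \<Longrightarrow> inprod H y (p \<oplus>\<^bsub>H\<^esub> r) = inprod H y q"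
    by (auto simp: op_proj_eq_embed_adj op_embed_adj_iff)
  let ?d = "r \<ominus>\<^bsub>H\<^esub> q"
  have d: "?d \<in> orth_compl H N" using orth_compl_diff[OF r q(1) N] .
  then have "inprod H ?d r = inprod H ?d q"
    using q(2)[OF d] orth[OF d] yc[OF d] by (simp add: inprod_add_right)
  then have "inprod H ?d ?d = 0" using yc[OF q(1)] yc[OF d] by (simp add: inprod_diff_right)
  then have "?d = \<zero>\<^bsub>H\<^esub>" using yc[OF d] inprod_pos[of ?d] by fastforce
  then show "q = r" using yc[OF q(1)] by (simp add: diff_eq_zero_iff)
qed

end

lemma (in hilbert_space) orthogonal_decomposition:
  assumes "closed_subspace H N" "x \<in> carrier H"
  obtains p r where "p \<in> N" "r \<in> orth_compl H N" "x = p \<oplus>\<^bsub>H\<^esub> r"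
proof -
  obtain p where p: "p \<in> N" "x \<ominus>\<^bsub>H\<^esub> p \<in> orth_compl H N"
    using projection assms by blast
  moreover have "x = p \<oplus>\<^bsub>H\<^esub> (x \<ominus>\<^bsub>H\<^esub> p)"
    using assms(2) p closed_subspaceD(1)[OF assms(1)]
    by (intro vector_eqI) (auto simp: inprod_linear subset_iff)
  ultimately show ?thesis using that by blast
qed

text \<open>
  Turns the equation between operators into one between sesquilinear forms on \<open>N\<close>: projecting to
  \<open>N\<close> does not change inner products with elements of \<open>N\<close>.
\<close>

lemma (in hilbert_space) compressions_agree:
  assumes N: "closed_subspace H N" and m: "bounded_map H m K" and mt: "bounded_map H mt Kt"
    and eq: "op_proj H N \<circ>\<^sub>o graph_on H m \<circ>\<^sub>o op_proj H N = op_proj H N \<circ>\<^sub>o graph_on H mt \<circ>\<^sub>o op_proj H N"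
    and x: "x \<in> N" and y: "y \<in> N"
  shows "inprod H (m x) y = inprod H (mt x) y"
proof -
  interpret m: bounded_map H m K by fact
  interpret mt: bounded_map H mt Kt by fact
  have Nc: "N \<subseteq> carrier H" using closed_subspaceD[OF N] by blast
  have xc: "x \<in> carrier H" and yc: "y \<in> carrier H" using x y Nc by auto
  obtain p where p: "p \<in> N" "m x \<ominus>\<^bsub>H\<^esub> p \<in> orth_compl H N"
    using projection[OF N m.m_closed[OF xc]] by blast
  have "(x, x) \<in> op_proj H N" using x xc by (simp add: op_proj_eq_embed_adj op_embed_adj_iff)
  moreover have "(x, m x) \<in> graph_on H m" using xc by (auto simp: graph_on_def)
  moreover have mp: "(m x, p) \<in> op_proj H N" using p xc by (simp add: op_proj_iff[OF Nc])
  ultimately have "(x, p) \<in> op_proj H N \<circ>\<^sub>o graph_on H m \<circ>\<^sub>o op_proj H N" by blast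
  then have "(x, p) \<in> op_proj H N \<circ>\<^sub>o graph_on H mt \<circ>\<^sub>o op_proj H N" using eq by simp
  then obtain x' where x': "(x, x') \<in> op_proj H N" "(mt x', p) \<in> op_proj H N"
    by (auto simp: graph_on_def)
  have "x = x'"
  proof (rule ccontr)
    have x'N: "x' \<in> N" and perp: "\<And>z. z \<in> N \<Longrightarrow> inprod H z x = inprod H z x'"
      using x'(1) by (auto simp: op_proj_eq_embed_adj op_embed_adj_iff)
    have x'c: "x' \<in> carrier H" using x'N Nc by blast
    assume "x \<noteq> x'"
    then have "x \<ominus>\<^bsub>H\<^esub> x' \<noteq> \<zero>\<^bsub>H\<^esub>" using xc x'c by (simp add: diff_eq_zero_iff)
    moreover have "inprod H (x \<ominus>\<^bsub>H\<^esub> x') (x \<ominus>\<^bsub>H\<^esub> x') = 0"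
      using perp[OF closed_subspaceD(5)[OF N x x'N]] xc x'c by (simp add: inprod_diff_right)
    ultimately show False using inprod_pos[of "x \<ominus>\<^bsub>H\<^esub> x'"] xc x'c by simp
  qed
  then have "inprod H y (m x) = inprod H y (mt x)"
    using mp x'(2) y by (simp add: op_proj_eq_embed_adj op_embed_adj_iff)
  then show ?thesis
    using inprod_commute[of y "m x"] inprod_commute[of y "mt x"] xc yc by simp
qed

section \<open>The estimate in a single fibre\<close>

locale fibre_problem = accretive_problem H m K c A
  for H :: "'h hilbert" and m and K c :: real and A +
  fixes N :: "'h set" and C :: real
  assumes closed_N: "closed_subspace H N"
    and intertwining: "op_proj H (orth_compl H N) \<circ>\<^sub>o A \<subseteq> A \<circ>\<^sub>o op_proj H (orth_compl H N)"
    and invertible_R: "boundedly_invertible (sub_hilbert H (orth_compl H N)) (sub_hilbert H (orth_compl H N))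
      (compression H (orth_compl H N) A)"
    and C_nonneg: "0 \<le> C"
    and inverse_bound: "opnorm (sub_hilbert H (orth_compl H N)) (sub_hilbert H (orth_compl H N))
      ((compression H (orth_compl H N) A)\<inverse>) \<le> ennreal C"
begin

lemma N_carrier: "x \<in> N \<Longrightarrow> x \<in> carrier H"
  using closed_subspaceD(1)[OF closed_N] by blast

lemma R_carrier: "x \<in> orth_compl H N \<Longrightarrow> x \<in> carrier H"
  by (simp add: orth_compl_def)

text \<open>
  Applying the intertwining inclusion to \<open>(p + r, y)\<close> shows that \<open>r\<close> alone is in the domain of \<open>A\<close> and
  that \<open>A r\<close> is the projection of \<open>y\<close> to the orthogonal complement of \<open>N\<close>. Invertibility of the
  compression then bounds \<open>r\<close> by that projection, and a fortiori by \<open>y\<close>.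
\<close>

lemma orthogonal_part_A:
  assumes A: "(p \<oplus>\<^bsub>H\<^esub> r, y) \<in> A" and p: "p \<in> N" and r: "r \<in> orth_compl H N"
  obtains s where "s \<in> orth_compl H N" "(r, s) \<in> A" "hnorm H r \<le> C * hnorm H y"
proof -
  let ?R = "orth_compl H N"
  let ?T = "(compression H ?R A)\<inverse>"
  note Nc = closed_subspaceD(1)[OF closed_N]
  have yc: "y \<in> carrier H" using A_carrier[OF A] by simp
  obtain q s where q: "q \<in> N" "s \<in> ?R" "y = q \<oplus>\<^bsub>H\<^esub> s"
    using orthogonal_decomposition[OF closed_N yc] by blast
  have qc: "q \<in> carrier H" "s \<in> carrier H" using q N_carrier R_carrier by auto
  have "(y, s) \<in> op_proj H ?R" using q op_proj_orth_compl[OF Nc q(1,2)] by simp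
  then have "(p \<oplus>\<^bsub>H\<^esub> r, s) \<in> A \<circ>\<^sub>o op_proj H ?R" using A intertwining by blast
  then have rs: "(r, s) \<in> A" using op_proj_orth_compl[OF Nc p r] by auto
  have lin: "linear_operator (sub_hilbert H ?R) (sub_hilbert H ?R) ?T"
    using invertible_R by (simp add: boundedly_invertible_def bounded_operators_def)
  have "(s, s) \<in> op_embed_adj H ?R" using q qc by (simp add: op_embed_adj_iff)
  then have sr: "(s, r) \<in> ?T" using r rs by (auto simp: compression_def op_embed_def)
  have sub: "?T \<subseteq> carrier H \<times> carrier H"
    using lin R_carrier by (auto simp: linear_operator_def)
  have smult: "(a \<odot>\<^bsub>H\<^esub> x, a \<odot>\<^bsub>H\<^esub> z) \<in> ?T" if "(x, z) \<in> ?T" for a x z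
    using lin that by (fastforce simp: linear_operator_def)
  have "opnorm H H ?T \<le> ennreal C"
    using inverse_bound by (simp add: opnorm_def hnorm_def)
  then have "hnorm H r \<le> C * hnorm H s"
    using hnorm_le_opnorm[OF sub smult _ C_nonneg sr] by blast
  also have "hnorm H s \<le> hnorm H y"
  proof (cases "hnorm H s = 0")
    case False
    then have pos: "hnorm H s > 0" using hnorm_nonneg[OF qc(2)] by simp
    have "inprod H y s = inprod H s s"
      using q qc inprod_orth_compl[OF Nc q(1,2)] by (simp add: inprod_add)
    then have "hnorm H s * hnorm H s \<le> hnorm H y * hnorm H s"
      using Re_inprod_le[OF yc qc(2)] hnorm_sq[OF qc(2)] by (simp add: power2_eq_square)
    then show ?thesis using pos by simp
  qed (use hnorm_nonneg yc in simp)
  finally show ?thesis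
    using that rs q C_nonneg by (simp add: mult_left_mono)
qed

text \<open>
  For a solution of \<open>m u + A u / \<epsilon> = f\<close>, the vector \<open>A u = \<epsilon> (f - m u)\<close> has norm at most
  \<open>\<epsilon> (1 + K / c) \<parallel>f\<parallel>\<close>, so that \<open>orthogonal_part_A\<close> applies with a small right-hand side.
\<close>

lemma orthogonal_part_solution:
  assumes B: "(p \<oplus>\<^bsub>H\<^esub> r, f) \<in> B \<epsilon>" and p: "p \<in> N" and r: "r \<in> orth_compl H N" and "\<epsilon> > 0"
  shows "hnorm H r \<le> C * (1 + K / c) * \<epsilon> * hnorm H f"
proof -
  let ?u = "p \<oplus>\<^bsub>H\<^esub> r"
  obtain y where y: "(?u, y) \<in> A" "f = m ?u \<oplus>\<^bsub>H\<^esub> complex_of_real (1 / \<epsilon>) \<odot>\<^bsub>H\<^esub> y"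
    using B unfolding B_iff by blast
  note [simp] = A_carrier[OF y(1)] B_carrier[OF B]
  have "y = complex_of_real \<epsilon> \<odot>\<^bsub>H\<^esub> (f \<ominus>\<^bsub>H\<^esub> m ?u)"
    unfolding y(2) using \<open>\<epsilon> > 0\<close> by (intro vector_eqI) (simp_all add: inprod_linear)
  then have "hnorm H y = \<epsilon> * hnorm H (f \<ominus>\<^bsub>H\<^esub> m ?u)"
    using \<open>\<epsilon> > 0\<close> hnorm_smult[of "f \<ominus>\<^bsub>H\<^esub> m ?u" "complex_of_real \<epsilon>"] by simp
  also have "hnorm H (f \<ominus>\<^bsub>H\<^esub> m ?u) \<le> hnorm H f + K * hnorm H ?u"
    using hnorm_diff_le[of f "m ?u"] m_bound[of ?u] by simp
  also have "hnorm H ?u \<le> hnorm H f / c"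
    using B_lower_bound[OF B] c_pos by (simp add: field_simps)
  finally have "hnorm H y \<le> \<epsilon> * (hnorm H f + K * (hnorm H f / c))"
    using \<open>\<epsilon> > 0\<close> K_nonneg by (simp add: mult_left_mono)
  moreover have "hnorm H r \<le> C * hnorm H y"
    using orthogonal_part_A[OF y(1) p r] by blast
  ultimately have "hnorm H r \<le> C * (\<epsilon> * (hnorm H f + K * (hnorm H f / c)))"
    using C_nonneg by (meson mult_left_mono order_trans)
  then show ?thesis by (simp add: algebra_simps)
qed

end

text \<open>
  The decisive estimate: the difference \<open>n\<close> of the parts in \<open>N\<close> is controlled by testing the
  difference of the two equations with \<open>n\<close>. The factor \<open>1 + K / c\<close> occurs once for the size of the parts
  \<open>r\<close> and \<open>s\<close> in the orthogonal complement, and once more because \<open>\<parallel>n\<parallel> \<le> K / c (\<parallel>r\<parallel> + \<parallel>s\<parallel>)\<close>.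
\<close>

theorem resolvent_difference:
  assumes "fibre_problem H m K c A N C" "fibre_problem H mt K c A N C" and "\<epsilon> > 0"
    and agree: "\<And>x y. x \<in> N \<Longrightarrow> y \<in> N \<Longrightarrow> inprod H (m x) y = inprod H (mt x) y"
    and u: "(u, f) \<in> B_op H (graph_on H m) A \<epsilon>"
    and v: "(v, f) \<in> B_op H (graph_on H mt) A \<epsilon>"
  shows "hnorm H (u \<ominus>\<^bsub>H\<^esub> v) \<le> 2 * C * (1 + K / c)\<^sup>2 * \<epsilon> * hnorm H f"
proof -
  interpret m: fibre_problem H m K c A N C by fact
  interpret mt: fibre_problem H mt K c A N C by fact
  note A_carrier = m.A_carrier and lin = m.inprod_linear
  obtain a where a: "(u, a) \<in> A" "f = m u \<oplus>\<^bsub>H\<^esub> complex_of_real (1 / \<epsilon>) \<odot>\<^bsub>H\<^esub> a"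
    using u unfolding m.B_iff by blast
  obtain b where b: "(v, b) \<in> A" "f = mt v \<oplus>\<^bsub>H\<^esub> complex_of_real (1 / \<epsilon>) \<odot>\<^bsub>H\<^esub> b"
    using v unfolding mt.B_iff by blast
  obtain p r where p: "p \<in> N" "r \<in> orth_compl H N" "u = p \<oplus>\<^bsub>H\<^esub> r"
    using m.orthogonal_decomposition[OF m.closed_N] A_carrier[OF a(1)] by blast
  obtain q s where q: "q \<in> N" "s \<in> orth_compl H N" "v = q \<oplus>\<^bsub>H\<^esub> s"
    using m.orthogonal_decomposition[OF m.closed_N] A_carrier[OF b(1)] by blast
  obtain a' where a': "a' \<in> orth_compl H N" "(r, a') \<in> A"
    using m.orthogonal_part_A a(1) p by metis
  obtain b' where b': "b' \<in> orth_compl H N" "(s, b') \<in> A"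
    using m.orthogonal_part_A b(1) q by metis
  note [simp] = A_carrier[OF a(1)] A_carrier[OF b(1)] A_carrier[OF a'(2)] A_carrier[OF b'(2)]
    m.N_carrier[OF p(1)] m.N_carrier[OF q(1)]
  define n where "n = p \<ominus>\<^bsub>H\<^esub> q"
  have nN: "n \<in> N" using m.closed_subspaceD(5)[OF m.closed_N p(1) q(1)] by (simp add: n_def)
  have [simp]: "n \<in> carrier H" by (simp add: n_def)
  have "n = (u \<ominus>\<^bsub>H\<^esub> r) \<ominus>\<^bsub>H\<^esub> (v \<ominus>\<^bsub>H\<^esub> s)"
    unfolding n_def p(3) q(3) by (intro m.vector_eqI) (simp_all add: lin)
  then have "(n, (a \<ominus>\<^bsub>H\<^esub> a') \<ominus>\<^bsub>H\<^esub> (b \<ominus>\<^bsub>H\<^esub> b')) \<in> A"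
    using m.A_diff a b a' b' by simp
  \<comment> \<open>\<open>a'\<close> and \<open>b'\<close> are orthogonal to \<open>n\<close>, so skewness in \<open>n\<close> removes \<open>A\<close> from the tested equation.\<close>
  from m.Re_inprod_A[OF this] have "Re (inprod H a n) = Re (inprod H b n)"
    using a'(1) b'(1) nN by (simp add: lin orth_compl_def)
  moreover have "inprod H (m u) n + inprod H a n / complex_of_real \<epsilon>
      = inprod H (mt v) n + inprod H b n / complex_of_real \<epsilon>"
    using arg_cong[OF a(2), of "\<lambda>g. inprod H g n"] arg_cong[OF b(2), of "\<lambda>g. inprod H g n"]
    by (simp add: lin)
  then have "Re (inprod H (m u) n) + Re (inprod H a n) / \<epsilon> = Re (inprod H (mt v) n) + Re (inprod H b n) / \<epsilon>"
    by (simp add: complex_eq_iff)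
  ultimately have "Re (inprod H (m u) n) = Re (inprod H (mt v) n)" by simp
  moreover have "inprod H (m u) n = inprod H (m p) n + inprod H (m r) n"
    by (simp add: p(3) m.m_add lin)
  moreover have "inprod H (mt v) n = inprod H (m q) n + inprod H (mt s) n"
    by (simp add: q(3) mt.m_add lin agree[OF q(1) nN])
  moreover have "inprod H (m n) n = inprod H (m p) n - inprod H (m q) n"
    using m.m_diff[of p q] by (simp add: n_def[symmetric] lin)
  ultimately have "Re (inprod H (m n) n) = Re (inprod H (mt s) n) - Re (inprod H (m r) n)"
    by simp
  also have "\<dots> \<le> hnorm H (mt s) * hnorm H n + hnorm H (m r) * hnorm H n"
    using m.Re_inprod_le[of "mt s" n] m.norm_inprod_le[of "m r" n]
      abs_Re_le_cmod[of "inprod H (m r) n"] by simp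
  also have "\<dots> \<le> K * hnorm H s * hnorm H n + K * hnorm H r * hnorm H n"
    using mt.m_bound[of s] m.m_bound[of r] by (intro add_mono mult_right_mono m.hnorm_nonneg) simp_all
  finally have test: "c * hnorm H n * hnorm H n \<le> K * (hnorm H s + hnorm H r) * hnorm H n"
    using m.coercive[of n] by (simp add: power2_eq_square algebra_simps)
  have n_le: "hnorm H n \<le> K / c * (hnorm H r + hnorm H s)"
  proof (cases "hnorm H n = 0")
    case True
    then show ?thesis using m.hnorm_nonneg[of r] m.hnorm_nonneg[of s] m.K_nonneg m.c_pos by simp
  next
    case False
    then have "hnorm H n > 0" using m.hnorm_nonneg[of n] by simp
    then have "c * hnorm H n \<le> K * (hnorm H s + hnorm H r)" using test by simp
    then show ?thesis using m.c_pos by (simp add: field_simps)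
  qed
  have "u \<ominus>\<^bsub>H\<^esub> v = n \<oplus>\<^bsub>H\<^esub> (r \<ominus>\<^bsub>H\<^esub> s)"
    unfolding n_def p(3) q(3) by (intro m.vector_eqI) (simp_all add: lin)
  then have "hnorm H (u \<ominus>\<^bsub>H\<^esub> v) \<le> hnorm H n + (hnorm H r + hnorm H s)"
    using m.hnorm_triangle[of n "r \<ominus>\<^bsub>H\<^esub> s"] m.hnorm_diff_le[of r s] by simp
  also have "\<dots> \<le> (1 + K / c) * (hnorm H r + hnorm H s)"
    using n_le by (simp add: distrib_right)
  also have "\<dots> \<le> (1 + K / c) * (2 * (C * (1 + K / c) * \<epsilon> * hnorm H f))"
  proof (rule mult_left_mono)
    have "hnorm H r \<le> C * (1 + K / c) * \<epsilon> * hnorm H f"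
      using m.orthogonal_part_solution u p \<open>\<epsilon> > 0\<close> by simp
    moreover have "hnorm H s \<le> C * (1 + K / c) * \<epsilon> * hnorm H f"
      using mt.orthogonal_part_solution v q \<open>\<epsilon> > 0\<close> by simp
    ultimately show "hnorm H r + hnorm H s \<le> 2 * (C * (1 + K / c) * \<epsilon> * hnorm H f)" by simp
  qed (use m.K_nonneg m.c_pos in simp)
  finally show ?thesis by (simp add: power2_eq_square mult_ac)
qed

lemma (in inner_product_space) op_minus_inverse_iff:
  "(f, w) \<in> op_minus H (S\<inverse>) (T\<inverse>) \<longleftrightarrow>
    (\<exists>u v. (u, f) \<in> S \<and> (v, f) \<in> T \<and> w = u \<oplus>\<^bsub>H\<^esub> (-1) \<odot>\<^bsub>H\<^esub> v)"
  by (auto simp: op_minus_def op_plus_def op_scale_def)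

section \<open>The uniform estimate\<close>

text \<open>
  The constants of the fibre estimate depend only on \<open>c\<close> and on bounds for the three suprema, so
  \<open>resolvent_difference\<close> in each fibre gives one constant for all.
\<close>

theorem theorem2p4:
  fixes \<Theta> :: "'t set"
    and H :: "'t \<Rightarrow> 'h hilbert"
    and M Mt A :: "'t \<Rightarrow> ('h \<times> 'h) set"
    and N :: "'t \<Rightarrow> 'h set"
    and c :: real
  assumes "\<Theta> \<noteq> {}"
    and "\<And>\<theta>. \<theta> \<in> \<Theta> \<Longrightarrow> hilbert_space (H \<theta>)"
    \<comment> \<open>standing assumptions\<close>
    and "\<And>\<theta>. \<theta> \<in> \<Theta> \<Longrightarrow> M \<theta> \<in> bounded_operators (H \<theta>) (H \<theta>)"
    and "(SUP \<theta>\<in>\<Theta>. opnorm (H \<theta>) (H \<theta>) (M \<theta>)) < \<infinity>"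
    and "\<And>\<theta>. \<theta> \<in> \<Theta> \<Longrightarrow> linear_operator (H \<theta>) (H \<theta>) (A \<theta>)"
    and "\<And>\<theta>. \<theta> \<in> \<Theta> \<Longrightarrow> densely_defined (H \<theta>) (A \<theta>)"
    and "\<And>\<theta>. \<theta> \<in> \<Theta> \<Longrightarrow> closed_operator (H \<theta>) (H \<theta>) (A \<theta>)"
    and "0 < c"
    and "\<And>\<theta>. \<theta> \<in> \<Theta> \<Longrightarrow> op_ge (H \<theta>) (op_Re (H \<theta>) (M \<theta>)) c"
    and "\<And>\<theta>. \<theta> \<in> \<Theta> \<Longrightarrow> A \<theta> = op_scale (H \<theta>) (-1) (op_adjoint (H \<theta>) (H \<theta>) (A \<theta>))"
    \<comment> \<open>fibre hypothesis\<close>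
    and "\<And>\<theta>. \<theta> \<in> \<Theta> \<Longrightarrow> closed_subspace (H \<theta>) (N \<theta>)"
    and "\<And>\<theta>. \<theta> \<in> \<Theta> \<Longrightarrow> opnorm (H \<theta>) (H \<theta>) (A \<theta> \<circ>\<^sub>o op_proj (H \<theta>) (N \<theta>)) < \<infinity>"
    and "\<And>\<theta>. \<theta> \<in> \<Theta> \<Longrightarrow>
      op_proj (H \<theta>) (orth_compl (H \<theta>) (N \<theta>)) \<circ>\<^sub>o A \<theta>
      \<subseteq> A \<theta> \<circ>\<^sub>o op_proj (H \<theta>) (orth_compl (H \<theta>) (N \<theta>))"
    and "\<And>\<theta>. \<theta> \<in> \<Theta> \<Longrightarrow>
      boundedly_invertible
        (sub_hilbert (H \<theta>) (orth_compl (H \<theta>) (N \<theta>)))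
        (sub_hilbert (H \<theta>) (orth_compl (H \<theta>) (N \<theta>)))
        (compression (H \<theta>) (orth_compl (H \<theta>) (N \<theta>)) (A \<theta>))"
    and "(SUP \<theta>\<in>\<Theta>. opnorm
        (sub_hilbert (H \<theta>) (orth_compl (H \<theta>) (N \<theta>)))
        (sub_hilbert (H \<theta>) (orth_compl (H \<theta>) (N \<theta>)))
        ((compression (H \<theta>) (orth_compl (H \<theta>) (N \<theta>)) (A \<theta>))\<inverse>)) < \<infinity>"
    \<comment> \<open>the perturbed coefficient\<close>
    and "\<And>\<theta>. \<theta> \<in> \<Theta> \<Longrightarrow> Mt \<theta> \<in> bounded_operators (H \<theta>) (H \<theta>)"
    and "(SUP \<theta>\<in>\<Theta>. opnorm (H \<theta>) (H \<theta>) (Mt \<theta>)) < \<infinity>"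
    and "\<And>\<theta>. \<theta> \<in> \<Theta> \<Longrightarrow> op_ge (H \<theta>) (op_Re (H \<theta>) (Mt \<theta>)) c"
    and "\<And>\<theta>. \<theta> \<in> \<Theta> \<Longrightarrow>
      op_proj (H \<theta>) (N \<theta>) \<circ>\<^sub>o M \<theta> \<circ>\<^sub>o op_proj (H \<theta>) (N \<theta>) =
      op_proj (H \<theta>) (N \<theta>) \<circ>\<^sub>o Mt \<theta> \<circ>\<^sub>o op_proj (H \<theta>) (N \<theta>)"
  shows "\<exists>\<kappa>>0. \<forall>\<theta>\<in>\<Theta>. \<forall>\<epsilon>>0.
    boundedly_invertible (H \<theta>) (H \<theta>) (B_op (H \<theta>) (M \<theta>) (A \<theta>) \<epsilon>) \<and>
    boundedly_invertible (H \<theta>) (H \<theta>) (B_op (H \<theta>) (Mt \<theta>) (A \<theta>) \<epsilon>) \<and>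
    opnorm (H \<theta>) (H \<theta>)
      (op_minus (H \<theta>) ((B_op (H \<theta>) (M \<theta>) (A \<theta>) \<epsilon>)\<inverse>) ((B_op (H \<theta>) (Mt \<theta>) (A \<theta>) \<epsilon>)\<inverse>))
    \<le> ennreal (\<kappa> * \<epsilon>)"
proof -
  let ?op = "\<lambda>\<theta> T. opnorm (H \<theta>) (H \<theta>) T"
  let ?R = "\<lambda>\<theta>. orth_compl (H \<theta>) (N \<theta>)"
  let ?inv = "\<lambda>\<theta>. opnorm (sub_hilbert (H \<theta>) (?R \<theta>)) (sub_hilbert (H \<theta>) (?R \<theta>))
    ((compression (H \<theta>) (?R \<theta>) (A \<theta>))\<inverse>)"
  define K where "K = enn2real (max (SUP \<theta>\<in>\<Theta>. ?op \<theta> (M \<theta>)) (SUP \<theta>\<in>\<Theta>. ?op \<theta> (Mt \<theta>)))"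
  define C where "C = enn2real (SUP \<theta>\<in>\<Theta>. ?inv \<theta>)"
  have K: "?op \<theta> (M \<theta>) \<le> ennreal K" "?op \<theta> (Mt \<theta>) \<le> ennreal K" if "\<theta> \<in> \<Theta>" for \<theta>
  proof -
    have "ennreal K = max (SUP \<theta>\<in>\<Theta>. ?op \<theta> (M \<theta>)) (SUP \<theta>\<in>\<Theta>. ?op \<theta> (Mt \<theta>))"
      unfolding K_def using assms(4,17) by (intro ennreal_enn2real) (simp add: max_def)
    then show "?op \<theta> (M \<theta>) \<le> ennreal K" "?op \<theta> (Mt \<theta>) \<le> ennreal K"
      using that by (auto simp: le_max_iff_disj intro: SUP_upper)
  qed
  have C: "?inv \<theta> \<le> ennreal C" if "\<theta> \<in> \<Theta>" for \<theta>
  proof -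
    have C: "ennreal C = (SUP \<theta>\<in>\<Theta>. ?inv \<theta>)"
      unfolding C_def using assms(15) by (intro ennreal_enn2real) simp
    show ?thesis unfolding C using that by (rule SUP_upper)
  qed
  have bounds_nonneg: "0 \<le> K" "0 \<le> C" by (simp_all add: K_def C_def)
  \<comment> \<open>The summand 1 only makes \<open>\<kappa>\<close> positive when \<open>C = 0\<close>.\<close>
  define \<kappa> where "\<kappa> = 2 * C * (1 + K / c)\<^sup>2 + 1"
  have "\<kappa> > 0" using bounds_nonneg by (simp add: \<kappa>_def add_nonneg_pos)
  moreover have "boundedly_invertible (H \<theta>) (H \<theta>) (B_op (H \<theta>) (M \<theta>) (A \<theta>) \<epsilon>) \<and>
      boundedly_invertible (H \<theta>) (H \<theta>) (B_op (H \<theta>) (Mt \<theta>) (A \<theta>) \<epsilon>) \<and>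
      ?op \<theta> (op_minus (H \<theta>) ((B_op (H \<theta>) (M \<theta>) (A \<theta>) \<epsilon>)\<inverse>) ((B_op (H \<theta>) (Mt \<theta>) (A \<theta>) \<epsilon>)\<inverse>))
        \<le> ennreal (\<kappa> * \<epsilon>)"
    if \<theta>: "\<theta> \<in> \<Theta>" and \<epsilon>: "\<epsilon> > 0" for \<theta> \<epsilon>
  proof -
    interpret hilbert_space "H \<theta>" by (rule assms(2)[OF \<theta>])
    obtain m where m: "bounded_map (H \<theta>) m K" "M \<theta> = graph_on (H \<theta>) m"
      using bounded_operator_graph[OF assms(3)[OF \<theta>] K(1)[OF \<theta>] bounds_nonneg(1)] by blast
    obtain mt where mt: "bounded_map (H \<theta>) mt K" "Mt \<theta> = graph_on (H \<theta>) mt"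
      using bounded_operator_graph[OF assms(16)[OF \<theta>] K(2)[OF \<theta>] bounds_nonneg(1)] by blast
    have problem: "fibre_problem (H \<theta>) m' K c (A \<theta>) (N \<theta>) C"
      if "bounded_map (H \<theta>) m' K" "op_ge (H \<theta>) (op_Re (H \<theta>) (graph_on (H \<theta>) m')) c" for m'
    proof -
      interpret bounded_map "H \<theta>" m' K by fact
      show ?thesis
        using op_Re_coercive[OF that] assms(5,10,11,13,14)[OF \<theta>] assms(8) C[OF \<theta>] bounds_nonneg
        by unfold_locales auto
    qed
    have fm: "fibre_problem (H \<theta>) m K c (A \<theta>) (N \<theta>) C"
      using problem[OF m(1)] assms(9)[OF \<theta>] m(2) by simp
    have fmt: "fibre_problem (H \<theta>) mt K c (A \<theta>) (N \<theta>) C"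
      using problem[OF mt(1)] assms(18)[OF \<theta>] mt(2) by simp
    interpret fm: fibre_problem "H \<theta>" m K c "A \<theta>" "N \<theta>" C by (rule fm)
    interpret fmt: fibre_problem "H \<theta>" mt K c "A \<theta>" "N \<theta>" C by (rule fmt)
    have agree: "inprod (H \<theta>) (m x) y = inprod (H \<theta>) (mt x) y" if "x \<in> N \<theta>" "y \<in> N \<theta>" for x y
      using compressions_agree[OF fm.closed_N m(1) mt(1) _ that] assms(19)[OF \<theta>] m(2) mt(2) by simp
    have "?op \<theta> (op_minus (H \<theta>) ((B_op (H \<theta>) (M \<theta>) (A \<theta>) \<epsilon>)\<inverse>) ((B_op (H \<theta>) (Mt \<theta>) (A \<theta>) \<epsilon>)\<inverse>))
        \<le> ennreal (\<kappa> * \<epsilon>)"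
    proof (rule opnorm_leI)
      fix f w
      assume "(f, w) \<in> op_minus (H \<theta>) ((B_op (H \<theta>) (M \<theta>) (A \<theta>) \<epsilon>)\<inverse>) ((B_op (H \<theta>) (Mt \<theta>) (A \<theta>) \<epsilon>)\<inverse>)"
        and f1: "hnorm (H \<theta>) f \<le> 1"
      then obtain u v where uv: "(u, f) \<in> fm.B \<epsilon>" "(v, f) \<in> fmt.B \<epsilon>"
        and w: "w = u \<oplus>\<^bsub>H \<theta>\<^esub> (-1) \<odot>\<^bsub>H \<theta>\<^esub> v"
        unfolding op_minus_inverse_iff m(2) mt(2) by blast
      have "w = u \<ominus>\<^bsub>H \<theta>\<^esub> v"
        using fm.B_carrier[OF uv(1)] fmt.B_carrier[OF uv(2)] unfolding w
        by (intro vector_eqI) (simp_all add: inprod_linear)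
      then have "hnorm (H \<theta>) w \<le> 2 * C * (1 + K / c)\<^sup>2 * \<epsilon> * hnorm (H \<theta>) f"
        using resolvent_difference[OF fm fmt \<epsilon> agree uv] by simp
      also have "\<dots> \<le> 2 * C * (1 + K / c)\<^sup>2 * \<epsilon> * 1"
        using f1 bounds_nonneg \<epsilon> by (intro mult_left_mono) simp_all
      also have "\<dots> \<le> \<kappa> * \<epsilon>"
        using \<epsilon> by (simp add: \<kappa>_def distrib_right)
      finally show "hnorm (H \<theta>) w \<le> \<kappa> * \<epsilon>" .
    qed
    then show ?thesis
      using fm.B_boundedly_invertible[OF \<epsilon>] fmt.B_boundedly_invertible[OF \<epsilon>] m(2) mt(2) by simp
  qed
  ultimately show ?thesis by blast
qed

end
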